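(* Let $\{Y_k\}$ be a fourth-order stationary sequence with $EY_k=0$, autocovariances $\gamma_j=\mathrm{Cov}(Y_0,Y_j)$ and fourth-order cumulants $\kappa(h,r,s)$, satisfying: (a) $n^{-1/2}\sum_{1\le j\le nt}Y_j\xrightarrow{d}\sigma W(t)$ in $D[0,1]$ for some $\sigma>0$, $W$ a standard Wiener process; (b) $\sum_j|\gamma_j|<\infty$; (c) $\sup_h\sum_{r,s}|\kappa(h,r,s)|<\infty$. Let $X_i=\mu+Y_i$, $1\le i\le n$, for a constant $\mu$. Suppose $q(n)\to\infty$ and $q(n)/n\to0$. Then $$T_n\xrightarrow{d}\sup_{0\le t\le1}|B(t)|,$$ where $B$ is a Brownian bridge.
   Context: A sequence is fourth-order stationary if it has finite fourth moments and its joint moments of order at most four are shift invariant; $\kappa(h,r,s)=E[Y_kY_{k+h}Y_{k+r}Y_{k+s}]-(\gamma_h\gamma_{r-s}+\gamma_r\gamma_{h-s}+\gamma_s\gamma_{h-r})$. $q(n)$ is a sequence of positive integers, $\omega_j(q)=1-j/(q+1)$, $\bar X_n=\frac1n\sum_{i\le n}X_i$, $\hat\gamma_j=\frac1n\sum_{1\le i\le n-j}(X_i-\bar X_n)(X_{i+j}-\bar X_n)$, $s_n^2=\hat\gamma_0+2\sum_{1\le j\le q(n)}\omega_j(q(n))\hat\gamma_j$, and $T_n=\frac1{n^{1/2}s_n}\max_{1\le k\le n}|\sum_{1\le i\le k}X_i-\frac kn\sum_{1\le i\le n}X_i|$. *)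

theory Defs
  imports "HOL-Probability.Probability"
begin

definition fourth_order_stationary :: "'a measure \<Rightarrow> (int \<Rightarrow> 'a \<Rightarrow> real) \<Rightarrow> bool" where
  "fourth_order_stationary M Y \<longleftrightarrow>
     (\<forall>k. Y k \<in> borel_measurable M) \<and>
     (\<forall>k. integrable M (\<lambda>\<omega>. (Y k \<omega>) ^ 4)) \<and>
     (\<forall>is :: int list. length is \<le> 4 \<longrightarrow> (\<forall>k.
        integral\<^sup>L M (\<lambda>\<omega>. \<Prod>i\<leftarrow>is. Y (k + i) \<omega>) = integral\<^sup>L M (\<lambda>\<omega>. \<Prod>i\<leftarrow>is. Y i \<omega>)))"

definition autocov :: "'a measure \<Rightarrow> (int \<Rightarrow> 'a \<Rightarrow> real) \<Rightarrow> int \<Rightarrow> real" where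
  "autocov M Y j = integral\<^sup>L M (\<lambda>\<omega>. Y 0 \<omega> * Y j \<omega>)
                   - integral\<^sup>L M (Y 0) * integral\<^sup>L M (Y j)"

text \<open>kappa(h,r,s) = E[Y_k Y_{k+h} Y_{k+r} Y_{k+s}] - (g_h g_{r-s} + g_r g_{h-s} + g_s g_{h-r}),
  taken at k = 0 (shift invariance).\<close>
definition cum4 :: "'a measure \<Rightarrow> (int \<Rightarrow> 'a \<Rightarrow> real) \<Rightarrow> int \<Rightarrow> int \<Rightarrow> int \<Rightarrow> real" where
  "cum4 M Y h r s = integral\<^sup>L M (\<lambda>\<omega>. Y 0 \<omega> * Y h \<omega> * Y r \<omega> * Y s \<omega>)
     - (autocov M Y h * autocov M Y (r - s) + autocov M Y r * autocov M Y (h - s)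
        + autocov M Y s * autocov M Y (h - r))"

definition cadlag01 :: "(real \<Rightarrow> real) set" where
  "cadlag01 = {x. (\<forall>t\<in>{0..<1}. (x \<longlongrightarrow> x t) (at_right t)) \<and>
                  (\<forall>t\<in>{0<..1}. \<exists>l. (x \<longlongrightarrow> l) (at_left t))}"

definition time_changes01 :: "(real \<Rightarrow> real) set" where
  "time_changes01 = {l. strict_mono_on {0..1} l \<and> continuous_on {0..1} l \<and> l 0 = 0 \<and> l 1 = 1}"

definition skorokhod_dist :: "(real \<Rightarrow> real) \<Rightarrow> (real \<Rightarrow> real) \<Rightarrow> real" where
  "skorokhod_dist x y = Inf {e. \<exists>l\<in>time_changes01.
      \<forall>t\<in>{0..1}. \<bar>l t - t\<bar> \<le> e \<and> \<bar>x t - y (l t)\<bar> \<le> e}"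

definition skorokhod_continuous :: "((real \<Rightarrow> real) \<Rightarrow> real) \<Rightarrow> bool" where
  "skorokhod_continuous f \<longleftrightarrow> (\<forall>x\<in>cadlag01. \<forall>\<epsilon>>0. \<exists>\<delta>>0. \<forall>y\<in>cadlag01.
      skorokhod_dist x y < \<delta> \<longrightarrow> \<bar>f y - f x\<bar> < \<epsilon>)"

definition conv_distr_D01 ::
  "'a measure \<Rightarrow> (nat \<Rightarrow> 'a \<Rightarrow> real \<Rightarrow> real) \<Rightarrow> 'b measure \<Rightarrow> ('b \<Rightarrow> real \<Rightarrow> real) \<Rightarrow> bool" where
  "conv_distr_D01 M Z N Z' \<longleftrightarrow>
     (\<forall>f. skorokhod_continuous f \<and> (\<exists>C. \<forall>x. \<bar>f x\<bar> \<le> C) \<longrightarrow>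
        (\<lambda>n. integral\<^sup>L M (\<lambda>\<omega>. f (Z n \<omega>))) \<longlonglongrightarrow> integral\<^sup>L N (\<lambda>\<omega>. f (Z' \<omega>)))"

definition wiener01 :: "'b measure \<Rightarrow> (real \<Rightarrow> 'b \<Rightarrow> real) \<Rightarrow> bool" where
  "wiener01 N W \<longleftrightarrow> prob_space N \<and>
     (\<forall>t. W t \<in> borel_measurable N) \<and>
     (\<forall>\<omega>\<in>space N. W 0 \<omega> = 0 \<and> continuous_on {0..1} (\<lambda>t. W t \<omega>)) \<and>
     (\<forall>s t. 0 \<le> s \<and> s < t \<and> t \<le> 1 \<longrightarrow>
        distributed N lborel (\<lambda>\<omega>. W t \<omega> - W s \<omega>) (normal_density 0 (sqrt (t - s)))) \<and>
     (\<forall>(ts :: nat \<Rightarrow> real) m. ts 0 \<ge> 0 \<and> ts m \<le> 1 \<and> (\<forall>i<m. ts i < ts (Suc i)) \<longrightarrow>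
        prob_space.indep_vars N (\<lambda>_. borel) (\<lambda>i \<omega>. W (ts (Suc i)) \<omega> - W (ts i) \<omega>) {..<m})"

definition brownian_bridge01 :: "'b measure \<Rightarrow> (real \<Rightarrow> 'b \<Rightarrow> real) \<Rightarrow> bool" where
  "brownian_bridge01 N B \<longleftrightarrow>
     (\<exists>W. wiener01 N W \<and> (\<forall>t \<omega>. B t \<omega> = W t \<omega> - t * W 1 \<omega>))"

text \<open>Sample X_1..X_n given as a function on nat (only indices 1..n are used).\<close>
definition sample_mean :: "(nat \<Rightarrow> real) \<Rightarrow> nat \<Rightarrow> real" where
  "sample_mean X n = (1 / real n) * (\<Sum>i=1..n. X i)"

definition sample_autocov :: "(nat \<Rightarrow> real) \<Rightarrow> nat \<Rightarrow> nat \<Rightarrow> real" where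
  "sample_autocov X n j = (1 / real n) *
     (\<Sum>i\<in>{i. 1 \<le> i \<and> i + j \<le> n}. (X i - sample_mean X n) * (X (i + j) - sample_mean X n))"

definition bartlett_weight :: "nat \<Rightarrow> nat \<Rightarrow> real" where
  "bartlett_weight q j = 1 - real j / (real q + 1)"

definition lrv_estimate :: "(nat \<Rightarrow> real) \<Rightarrow> nat \<Rightarrow> nat \<Rightarrow> real" where
  "lrv_estimate X n q = sample_autocov X n 0 +
     2 * (\<Sum>j=1..q. bartlett_weight q j * sample_autocov X n j)"

definition cusum_stat :: "(nat \<Rightarrow> real) \<Rightarrow> nat \<Rightarrow> nat \<Rightarrow> real" where
  "cusum_stat X n q = (1 / (sqrt (real n) * sqrt (lrv_estimate X n q))) *
     Max ((\<lambda>k. \<bar>(\<Sum>i=1..k. X i) - real k / real n * (\<Sum>i=1..n. X i)\<bar>) ` {1..n})"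

end

theory Submission
  imports Defs
begin

text \<open>
  The functional \<open>x \<mapsto> sup |x t - t x 1|\<close> is continuous in the Skorokhod topology, so the invariance
  principle gives convergence of the unnormalised CUSUM maximum to \<open>\<sigma> sup |B|\<close>. It remains to see
  that \<open>s_n\<^sup>2 \<rightarrow> \<sigma>\<^sup>2\<close> in probability. Writing \<open>s_n\<^sup>2\<close> as a quadratic form in the sample with
  Bartlett kernel, the summability of \<open>\<gamma>\<close> and \<open>\<kappa>\<close> bounds its variance by a multiple of
  \<open>q(n) / n\<close>, and its mean differs from \<open>E S_n\<^sup>2 / n\<close> by \<open>o(1)\<close>. The same variance bound with constant
  weights bounds \<open>E S_n\<^sup>4 / n\<^sup>2\<close>, so that \<open>S_n\<^sup>2 / n\<close> is uniformly integrable and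
  \<open>E S_n\<^sup>2 / n \<rightarrow> \<sigma>\<^sup>2\<close> follows from the convergence in distribution of \<open>S_n / \<surd>n\<close> to \<open>\<sigma> W(1)\<close>.
\<close>

section \<open>A Skorokhod-continuous functional\<close>

text \<open>Hypothesis (a) and the conclusion may speak of different Wiener processes on different
  probability spaces, so the law of the bridge supremum must be shown to depend only on the axioms
  in \<open>wiener01\<close>. These describe finitely many increments and the continuity of paths,
  whence the passage through maxima over grids. Hypothesis (a) ties \<sigma> to the sequence only
  through the limit law, and convergence in distribution does not by itself carry second moments.
  This is why \<open>E S_n^2 / n\<close>, rather than the series of autocovariances, is the
  reference point for the mean of the estimator. The variance of a quadratic form is of the order of
  the number of its pairs because each row of covariances is absolutely summable, uniformly in the
  row; the supremum over \<open>h\<close> in (c) supplies this uniformity. The Bartlett kernel lives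
  on at most \<open>n (2 q + 1)\<close> pairs, and division by \<open>n^2\<close> leaves the order
  \<open>q / n\<close>. The CUSUM maximum runs over grid points while the functional sees all of
  [0, 1]; the discrepancy is the drift across one cell, of order \<open>1 / n\<close> in
  mean.\<close>

lemma cadlag01_bounded:
  assumes "x \<in> cadlag01"
  shows "\<exists>C. \<forall>t\<in>{0..1}. \<bar>x t\<bar> \<le> C"
proof -
  \<comment> \<open>Boundedness is local, since one-sided limits control each side of a point, and
    it is additive over adjacent intervals, so interval subdivision applies. The intersection with
    \<open>{0..1}\<close> is there because the local condition of \<open>Bolzano\<close> also
    quantifies over intervals that stick out of [0, 1].\<close>
  define P where "P a b \<longleftrightarrow> (\<exists>C. \<forall>t\<in>{a..b} \<inter> {0..1}. \<bar>x t\<bar> \<le> C)" for a b :: real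
  have "P 0 1"
  proof (rule Bolzano)
    fix a b c assume "P a b" "P b c" "a \<le> b" "b \<le> c"
    then obtain C1 C2 where "\<forall>t\<in>{a..b} \<inter> {0..1}. \<bar>x t\<bar> \<le> C1" "\<forall>t\<in>{b..c} \<inter> {0..1}. \<bar>x t\<bar> \<le> C2"
      unfolding P_def by blast
    moreover have "t \<in> {a..b} \<or> t \<in> {b..c}" if "t \<in> {a..c}" for t using that by auto
    ultimately have "\<forall>t\<in>{a..c} \<inter> {0..1}. \<bar>x t\<bar> \<le> max C1 C2"
      by (fastforce simp: le_max_iff_disj)
    then show "P a c" unfolding P_def by blast
  next
    fix t :: real assume t: "0 \<le> t" "t \<le> 1"
    have near: "\<exists>d>0. \<exists>C. \<forall>s\<in>S. s \<noteq> t \<and> dist s t < d \<longrightarrow> \<bar>x s\<bar> \<le> C"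
      if "(x \<longlongrightarrow> l) (at t within S)" for l S
    proof -
      have "eventually (\<lambda>s. dist (x s) l < 1) (at t within S)"
        using that by (rule tendstoD) simp
      then obtain d where "d > 0" "\<forall>s\<in>S. s \<noteq> t \<and> dist s t < d \<longrightarrow> dist (x s) l < 1"
        unfolding eventually_at by blast
      then have "\<forall>s\<in>S. s \<noteq> t \<and> dist s t < d \<longrightarrow> \<bar>x s\<bar> \<le> \<bar>l\<bar> + 1"
        by (fastforce simp: dist_real_def)
      with \<open>d > 0\<close> show ?thesis by blast
    qed
    have "\<exists>d>0. \<exists>C. \<forall>s\<in>{t<..}. s \<le> 1 \<and> s \<noteq> t \<and> dist s t < d \<longrightarrow> \<bar>x s\<bar> \<le> C"
    proof (cases "t < 1")
      case True
      then have "(x \<longlongrightarrow> x t) (at_right t)" using assms t by (auto simp: cadlag01_def)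
      from near[OF this] show ?thesis by blast
    qed (use t in \<open>auto intro!: exI[of _ 1]\<close>)
    then obtain d1 C1 where 1: "d1 > 0" "\<And>s. s > t \<Longrightarrow> s \<le> 1 \<Longrightarrow> dist s t < d1 \<Longrightarrow> \<bar>x s\<bar> \<le> C1"
      by fastforce
    have "\<exists>d>0. \<exists>C. \<forall>s\<in>{..<t}. s \<ge> 0 \<and> s \<noteq> t \<and> dist s t < d \<longrightarrow> \<bar>x s\<bar> \<le> C"
    proof (cases "t > 0")
      case True
      then have "t \<in> {0<..1}" using t by simp
      then obtain l where "(x \<longlongrightarrow> l) (at_left t)" using assms unfolding cadlag01_def by blast
      from near[OF this] show ?thesis by blast
    qed (use t in \<open>auto intro!: exI[of _ 1]\<close>)
    then obtain d2 C2 where 2: "d2 > 0" "\<And>s. s < t \<Longrightarrow> s \<ge> 0 \<Longrightarrow> dist s t < d2 \<Longrightarrow> \<bar>x s\<bar> \<le> C2"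
      by fastforce
    show "\<exists>d>0. \<forall>a b. a \<le> t \<and> t \<le> b \<and> b - a < d \<longrightarrow> P a b"
    proof (intro exI[of _ "min d1 d2"] conjI allI impI)
      fix a b assume ab: "a \<le> t \<and> t \<le> b \<and> b - a < min d1 d2"
      have "\<bar>x s\<bar> \<le> max \<bar>x t\<bar> (max C1 C2)" if "s \<in> {a..b} \<inter> {0..1}" for s
        using 1(2)[of s] 2(2)[of s] that ab
        by (cases s t rule: linorder_cases) (auto simp: dist_real_def le_max_iff_disj)
      then show "P a b" unfolding P_def by blast
    qed (use 1 2 in simp)
  qed simp
  then show ?thesis by (simp add: P_def)
qed

text \<open>An infimum of reals is informative only for a nonempty set. Boundedness of both paths
  supplies an element: the identity time change with error \<open>C + D\<close>.\<close>

lemma skorokhod_dist_lessD: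
  assumes "x \<in> cadlag01" "y \<in> cadlag01" "skorokhod_dist x y < d"
  obtains l e where "l \<in> time_changes01" "e < d"
    "\<And>t. t \<in> {0..1} \<Longrightarrow> \<bar>l t - t\<bar> \<le> e" "\<And>t. t \<in> {0..1} \<Longrightarrow> \<bar>x t - y (l t)\<bar> \<le> e"
proof -
  let ?S = "{e. \<exists>l\<in>time_changes01. \<forall>t\<in>{0..1}. \<bar>l t - t\<bar> \<le> e \<and> \<bar>x t - y (l t)\<bar> \<le> e}"
  obtain C where C: "\<And>t. t \<in> {0..1} \<Longrightarrow> \<bar>x t\<bar> \<le> C" using cadlag01_bounded[OF assms(1)] by blast
  obtain D where D: "\<And>t. t \<in> {0..1} \<Longrightarrow> \<bar>y t\<bar> \<le> D" using cadlag01_bounded[OF assms(2)] by blast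
  have "0 \<le> C + D" using C[of 0] D[of 0] by simp
  moreover have "\<bar>x t - y t\<bar> \<le> C + D" if "t \<in> {0..1}" for t using C[OF that] D[OF that] by linarith
  moreover have "(\<lambda>t. t) \<in> time_changes01"
    by (auto simp: time_changes01_def strict_mono_on_def)
  ultimately have "C + D \<in> ?S" by (auto intro!: bexI[of _ "\<lambda>t. t"])
  then have "?S \<noteq> {}" by blast
  then obtain e where "e \<in> ?S" "e < d"
    using cInf_lessD[of ?S d] assms(3) unfolding skorokhod_dist_def by blast
  then show thesis using that by blast
qed

text \<open>Every time of the second path is hit, so suprema over [0, 1] can be compared in both
  directions.\<close>

lemma time_change_surj:
  assumes "l \<in> time_changes01"
  shows "l ` {0..1} = {0..1}"
proof
  have mono: "mono_on {0..1} l"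
    using assms by (auto simp: time_changes01_def intro: strict_mono_on_imp_mono_on)
  show "l ` {0..1} \<subseteq> {0..1}"
  proof safe
    fix t :: real assume "t \<in> {0..1}"
    then have "l 0 \<le> l t" "l t \<le> l 1" by (auto intro!: mono_onD[OF mono])
    then show "l t \<in> {0..1}" using assms by (auto simp: time_changes01_def)
  qed
  show "{0..1} \<subseteq> l ` {0..1}"
  proof
    fix u :: real assume "u \<in> {0..1}"
    then have "\<exists>t. 0 \<le> t \<and> t \<le> 1 \<and> l t = u"
      using assms by (intro IVT') (auto simp: time_changes01_def)
    then show "u \<in> l ` {0..1}" by auto
  qed
qed

text \<open>The bridge is formed inside the functional, so that it acts on the partial sum paths
  themselves. At a Wiener path its value is the supremum of the absolute Brownian bridge.\<close>

definition bridge_sup :: "(real \<Rightarrow> real) \<Rightarrow> real" where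
  "bridge_sup x = (SUP t\<in>{0..1}. \<bar>x t - t * x 1\<bar>)"

lemma bdd_above_bridge:
  assumes "x \<in> cadlag01" "A \<subseteq> {0..1}"
  shows "bdd_above ((\<lambda>t. \<bar>x t - t * x 1\<bar>) ` A)"
proof -
  obtain C where C: "\<And>t. t \<in> {0..1} \<Longrightarrow> \<bar>x t\<bar> \<le> C" using cadlag01_bounded[OF assms(1)] by blast
  have "\<bar>x t - t * x 1\<bar> \<le> C + C" if "t \<in> {0..1}" for t
  proof -
    have "\<bar>t * x 1\<bar> \<le> 1 * C" unfolding abs_mult using that C[of 1] by (intro mult_mono) auto
    then show ?thesis using C[OF that] by linarith
  qed
  then show ?thesis using assms(2) by (intro bdd_aboveI2[of _ _ "C + C"]) auto
qed

lemma bridge_sup_upper: "x \<in> cadlag01 \<Longrightarrow> t \<in> {0..1} \<Longrightarrow> \<bar>x t - t * x 1\<bar> \<le> bridge_sup x"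
  unfolding bridge_sup_def by (intro cSUP_upper bdd_above_bridge) auto

lemma bridge_sup_least: "(\<And>t. t \<in> {0..1} \<Longrightarrow> \<bar>x t - t * x 1\<bar> \<le> c) \<Longrightarrow> bridge_sup x \<le> c"
  unfolding bridge_sup_def by (intro cSUP_least) auto

text \<open>The invariance principle tests bounded functionals only, whereas endpoint and supremum
  are unbounded; a bounded continuous \<open>g\<close> will be put in front of them.\<close>

lemma skorokhod_continuous_compose:
  assumes "continuous_on UNIV g"
    and "\<And>x e. x \<in> cadlag01 \<Longrightarrow> e > 0 \<Longrightarrow>
           \<exists>d>0. \<forall>y\<in>cadlag01. skorokhod_dist x y < d \<longrightarrow> \<bar>F y - F x\<bar> < (e::real)"
  shows "skorokhod_continuous (\<lambda>x. g (F x))"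
  unfolding skorokhod_continuous_def
proof (intro ballI allI impI)
  fix x and e :: real assume x: "x \<in> cadlag01" and e: "e > 0"
  obtain r where r: "r > 0" "\<And>u. \<bar>u - F x\<bar> < r \<Longrightarrow> \<bar>g u - g (F x)\<bar> < e"
    using assms(1) e unfolding continuous_on_iff dist_real_def by (metis UNIV_I)
  show "\<exists>d>0. \<forall>y\<in>cadlag01. skorokhod_dist x y < d \<longrightarrow> \<bar>g (F y) - g (F x)\<bar> < e"
    using assms(2)[OF x r(1)] r(2) by blast
qed

text \<open>Time changes fix 1, so evaluation there is continuous, unlike evaluation at an interior
  jump.\<close>

lemma skorokhod_continuous_endpoint:
  assumes "continuous_on UNIV g"
  shows "skorokhod_continuous (\<lambda>x. g (x 1))"
proof (rule skorokhod_continuous_compose[OF assms])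
  fix x and e :: real assume x: "x \<in> cadlag01" and e: "e > 0"
  have "\<bar>y 1 - x 1\<bar> < e" if "y \<in> cadlag01" "skorokhod_dist x y < e" for y
  proof -
    from skorokhod_dist_lessD[OF x that] obtain l e' where
      l: "l \<in> time_changes01" "e' < e" "\<And>t. t \<in> {0..1} \<Longrightarrow> \<bar>x t - y (l t)\<bar> \<le> e'" by metis
    have "l 1 = 1" using l(1) by (simp add: time_changes01_def)
    then show ?thesis using l(2) l(3)[of 1] by simp
  qed
  with e show "\<exists>d>0. \<forall>y\<in>cadlag01. skorokhod_dist x y < d \<longrightarrow> \<bar>y 1 - x 1\<bar> < e" by blast
qed

text \<open>A time change preserves suprema of paths but moves the drift \<open>t * x 1\<close>;
  that displacement is small because \<open>l\<close> is close to the identity.\<close>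

lemma skorokhod_continuous_bridge_sup:
  assumes "continuous_on UNIV g"
  shows "skorokhod_continuous (\<lambda>x. g (bridge_sup x))"
proof (rule skorokhod_continuous_compose[OF assms])
  fix x and e :: real assume x: "x \<in> cadlag01" and e: "e > 0"
  \<comment> \<open>Three errors are collected: \<open>r\<close> from \<open>x t - y (l t)\<close>,
    \<open>r\<close> from the change of endpoint value, and \<open>r * \<bar>x 1\<bar>\<close> from
    the displaced drift.\<close>
  define K where "K = 2 + \<bar>x 1\<bar>"
  have K: "K > 0" by (simp add: K_def)
  have "\<bar>bridge_sup y - bridge_sup x\<bar> < e" if y: "y \<in> cadlag01" and d: "skorokhod_dist x y < e / K" for y
  proof -
    from skorokhod_dist_lessD[OF x y d] obtain l r where
      l: "l \<in> time_changes01" "r < e / K" "\<And>t. t \<in> {0..1} \<Longrightarrow> \<bar>l t - t\<bar> \<le> r"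
        "\<And>t. t \<in> {0..1} \<Longrightarrow> \<bar>x t - y (l t)\<bar> \<le> r" by metis
    have l1: "l 1 = 1" using l(1) by (simp add: time_changes01_def)
    have lin: "l t \<in> {0..1}" if "t \<in> {0..1}" for t using time_change_surj[OF l(1)] that by blast
    have close: "\<bar>(x t - t * x 1) - (y (l t) - l t * y 1)\<bar> \<le> r * K" if t: "t \<in> {0..1}" for t
    proof -
      have "\<bar>x 1 - y 1\<bar> \<le> r" using l(4)[of 1] l1 by simp
      moreover have "\<bar>l t\<bar> \<le> 1" using lin[OF t] by auto
      ultimately have a: "\<bar>l t * (y 1 - x 1)\<bar> \<le> 1 * r"
        unfolding abs_mult by (intro mult_mono) auto
      have b: "\<bar>(l t - t) * x 1\<bar> \<le> r * \<bar>x 1\<bar>"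
        unfolding abs_mult using l(3)[OF t] by (intro mult_right_mono) auto
      have "(x t - t * x 1) - (y (l t) - l t * y 1)
          = (x t - y (l t)) + l t * (y 1 - x 1) + (l t - t) * x 1"
        by (simp add: algebra_simps)
      then show ?thesis using a b l(4)[OF t] by (simp add: K_def algebra_simps)
    qed
    have "bridge_sup x \<le> bridge_sup y + r * K"
    proof (rule bridge_sup_least)
      fix t :: real assume t: "t \<in> {0..1}"
      show "\<bar>x t - t * x 1\<bar> \<le> bridge_sup y + r * K"
        using close[OF t] bridge_sup_upper[OF y lin[OF t]] by linarith
    qed
    moreover have "bridge_sup y \<le> bridge_sup x + r * K"
    proof (rule bridge_sup_least)
      fix u :: real assume "u \<in> {0..1}"
      then obtain t where t: "t \<in> {0..1}" "u = l t" using time_change_surj[OF l(1)] by blast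
      show "\<bar>y u - u * y 1\<bar> \<le> bridge_sup x + r * K"
        unfolding t(2) using close[OF t(1)] bridge_sup_upper[OF x t(1)] by linarith
    qed
    moreover have "r * K < e" using l(2) K by (simp add: pos_less_divide_eq)
    ultimately show ?thesis by linarith
  qed
  moreover have "e / K > 0" using e K by simp
  ultimately show "\<exists>d>0. \<forall>y\<in>cadlag01. skorokhod_dist x y < d \<longrightarrow> \<bar>bridge_sup y - bridge_sup x\<bar> < e"
    by blast
qed

text \<open>By right continuity, a value exceeding the rational supremum would be exceeded at nearby
  rationals on the right as well. The countable supremum is what makes \<open>bridge_sup\<close>
  measurable.\<close>

lemma bridge_sup_rat:
  assumes x: "x \<in> cadlag01"
  shows "bridge_sup x = (SUP t\<in>{0..1} \<inter> \<rat>. \<bar>x t - t * x 1\<bar>)" (is "_ = ?S")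
proof (rule antisym)
  have up: "\<bar>x t - t * x 1\<bar> \<le> ?S" if "t \<in> {0..1} \<inter> \<rat>" for t
    using that by (intro cSUP_upper bdd_above_bridge[OF x]) auto
  show "bridge_sup x \<le> ?S"
  proof (rule bridge_sup_least)
    fix t :: real assume t: "t \<in> {0..1}"
    show "\<bar>x t - t * x 1\<bar> \<le> ?S"
    proof (cases "t = 1")
      \<comment> \<open>The time 1 has no right neighbours in [0, 1], but it is itself
        rational.\<close>
      case True
      then show ?thesis using up[of 1] by simp
    next
      case False
      with t have t: "0 \<le> t" "t < 1" by auto
      have lim: "((\<lambda>s. \<bar>x s - s * x 1\<bar>) \<longlongrightarrow> \<bar>x t - t * x 1\<bar>) (at_right t)"
        using x t by (intro tendsto_intros) (auto simp: cadlag01_def)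
      show ?thesis
      proof (rule ccontr)
        assume "\<not> ?thesis"
        then have "eventually (\<lambda>s. \<bar>x s - s * x 1\<bar> > ?S) (at_right t)"
          using order_tendstoD(1)[OF lim] by simp
        moreover have "eventually (\<lambda>s. s < 1) (at_right t)"
          using t(2) by (intro eventually_at_rightI[of t 1]) auto
        ultimately have "eventually (\<lambda>s. \<bar>x s - s * x 1\<bar> > ?S \<and> s < 1) (at_right t)"
          by (rule eventually_conj)
        then obtain b where b: "b > t" "\<And>s. s > t \<Longrightarrow> s < b \<Longrightarrow> \<bar>x s - s * x 1\<bar> > ?S \<and> s < 1"
          unfolding eventually_at_right_field by blast
        obtain s where "s \<in> \<rat>" "t < s" "s < b" using Rats_dense_in_real[OF b(1)] by blast
        with b(2)[of s] up[of s] t show False by auto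
      qed
    qed
  qed
  have "0 \<in> {0..1} \<inter> (\<rat> :: real set)" by simp
  then show "?S \<le> bridge_sup x"
    using bridge_sup_upper[OF x] by (intro cSUP_least) blast+
qed

lemma measurable_bridge_sup:
  assumes "\<And>\<omega>. \<omega> \<in> space M \<Longrightarrow> Z \<omega> \<in> cadlag01"
    and [measurable]: "\<And>t. (\<lambda>\<omega>. Z \<omega> t) \<in> borel_measurable M"
  shows "(\<lambda>\<omega>. bridge_sup (Z \<omega>)) \<in> borel_measurable M"
proof -
  have "(\<lambda>\<omega>. SUP t\<in>{0..1} \<inter> \<rat>. \<bar>Z \<omega> t - t * Z \<omega> 1\<bar>) \<in> borel_measurable M"
    using bdd_above_bridge[OF assms(1)]
    by (intro borel_measurable_cSUP) (auto intro: countable_Int2 countable_rat)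
  then show ?thesis
    using assms(1) by (subst measurable_cong[OF bridge_sup_rat]) auto
qed

lemma continuous_imp_cadlag01:
  assumes "continuous_on {0..1} x"
  shows "x \<in> cadlag01"
proof -
  have "(x \<longlongrightarrow> x t) (at_right t)" if "t \<in> {0..<1}" for t
  proof -
    have "(x \<longlongrightarrow> x t) (at t within {t..1})"
      using assms that unfolding continuous_on_def by (auto intro: tendsto_within_subset[of _ _ _ "{0..1}"])
    then show ?thesis using that by (simp add: at_within_Icc_at_right)
  qed
  moreover have "(x \<longlongrightarrow> x t) (at_left t)" if "t \<in> {0<..1}" for t
  proof -
    have "(x \<longlongrightarrow> x t) (at t within {0..t})"
      using assms that unfolding continuous_on_def by (auto intro: tendsto_within_subset[of _ _ _ "{0..1}"])
    then show ?thesis using that by (simp add: at_within_Icc_at_left)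
  qed
  ultimately show ?thesis unfolding cadlag01_def by blast
qed

section \<open>Uniqueness of the law of the bridge supremum\<close>

text \<open>Only finitely many increments of the path enter, so \<open>wiener01\<close> determines
  its law; refining the grid then reaches \<open>bridge_sup\<close>.\<close>

definition bridge_grid_max :: "nat \<Rightarrow> (real \<Rightarrow> real) \<Rightarrow> real" where
  "bridge_grid_max m x = Max ((\<lambda>k. \<bar>x (real k / real m) - real k / real m * x 1\<bar>) ` {..m})"

lemma bridge_grid_max_tendsto:
  assumes "continuous_on {0..1} x"
  shows "(\<lambda>m. bridge_grid_max (Suc m) x) \<longlonglongrightarrow> bridge_sup x"
proof -
  let ?f = "\<lambda>t. \<bar>x t - t * x 1\<bar>"
  have cf: "continuous_on {0..1} ?f" by (intro continuous_intros assms)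
  obtain t where t: "t \<in> {0..1}" and max: "\<And>s. s \<in> {0..1} \<Longrightarrow> ?f s \<le> ?f t"
    using continuous_attains_sup[of "{0..1}" ?f] cf by auto
  have eq: "bridge_sup x = ?f t"
    using t max bridge_sup_upper[OF continuous_imp_cadlag01[OF assms] t]
    by (intro antisym bridge_sup_least) auto
  \<comment> \<open>The maximiser \<open>t\<close> is rounded down to the grid. The value at the
    rounded point is a lower bound for the grid maximum and tends to the full maximum by continuity.
    The mesh is \<open>1 / Suc m\<close> to keep the divisor positive.\<close>
  define k where "k m = nat \<lfloor>real (Suc m) * t\<rfloor>" for m
  define s where "s m = real (k m) / real (Suc m)" for m
  have k: "real (k m) \<le> real (Suc m) * t" "real (Suc m) * t < real (k m) + 1" for m
    using t by (auto simp: k_def)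
  have s: "t - 1 / real (Suc m) \<le> s m" "s m \<le> t" for m
  proof -
    have t_eq: "t = real (Suc m) * t / real (Suc m)" by simp
    have "t - 1 / real (Suc m) = (real (Suc m) * t - 1) / real (Suc m)"
      by (subst t_eq, subst diff_divide_distrib) simp
    also have "\<dots> \<le> s m" unfolding s_def using k[of m] by (intro divide_right_mono) auto
    finally show "t - 1 / real (Suc m) \<le> s m" .
    show "s m \<le> t" unfolding s_def by (subst t_eq, rule divide_right_mono) (use k[of m] in auto)
  qed
  have s0: "s m \<in> {0..1}" for m using order.trans[OF s(2)[of m], of 1] t by (auto simp: s_def)
  have "s \<longlonglongrightarrow> t"
  proof (rule tendsto_sandwich)
    show "(\<lambda>m. t - 1 / real (Suc m)) \<longlonglongrightarrow> t"
      using tendsto_diff[OF tendsto_const[of t] LIMSEQ_inverse_real_of_nat] by (simp add: inverse_eq_divide)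
  qed (use s in auto)
  then have lim: "(\<lambda>m. ?f (s m)) \<longlonglongrightarrow> ?f t"
    using continuous_on_tendsto_compose[OF cf, of s t sequentially] s0 t by simp
  have "?f (s m) \<le> bridge_grid_max (Suc m) x" for m
  proof -
    have "real (k m) \<le> real (Suc m) * t" by (rule k)
    also have "\<dots> \<le> real (Suc m) * 1" using t by (intro mult_left_mono) auto
    finally have "real (k m) \<le> real (Suc m)" by simp
    then show ?thesis unfolding bridge_grid_max_def s_def by (intro Max_ge) auto
  qed
  moreover have "bridge_grid_max (Suc m) x \<le> ?f t" for m
    unfolding bridge_grid_max_def
  proof (rule Max.boundedI)
    fix a assume "a \<in> (\<lambda>k. ?f (real k / real (Suc m))) ` {..Suc m}"
    then obtain k where "k \<le> Suc m" "a = ?f (real k / real (Suc m))" by auto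
    then show "a \<le> ?f t" using max[of "real k / real (Suc m)"] by simp
  qed auto
  ultimately show ?thesis
    unfolding eq by (intro tendsto_sandwich[OF _ _ lim tendsto_const]) auto
qed

text \<open>The right-hand side mentions neither \<open>N\<close> nor \<open>W\<close>: this is
  where the law becomes independent of the chosen process.\<close>

lemma wiener01_increments_distr:
  assumes W: "wiener01 N W" and m: "m > 0"
  shows "distr N (\<Pi>\<^sub>M i\<in>{..<m}. borel)
           (\<lambda>\<omega>. \<lambda>i\<in>{..<m}. W (real (Suc i) / real m) \<omega> - W (real i / real m) \<omega>)
       = (\<Pi>\<^sub>M i\<in>{..<m}. density lborel (normal_density 0 (sqrt (1 / real m))))"
proof -
  interpret prob_space N using W by (simp add: wiener01_def)
  have [measurable]: "W t \<in> borel_measurable N" for t using W by (simp add: wiener01_def)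
  define ts where "ts i = real i / real m" for i
  have "indep_vars (\<lambda>_. borel) (\<lambda>i \<omega>. W (ts (Suc i)) \<omega> - W (ts i) \<omega>) {..<m}"
  proof -
    have "0 \<le> ts 0 \<and> ts m \<le> 1 \<and> (\<forall>i<m. ts i < ts (Suc i))"
      using m by (auto simp: ts_def divide_strict_right_mono)
    then show ?thesis using W unfolding wiener01_def by blast
  qed
  then have "distr N (\<Pi>\<^sub>M i\<in>{..<m}. borel) (\<lambda>\<omega>. \<lambda>i\<in>{..<m}. W (ts (Suc i)) \<omega> - W (ts i) \<omega>)
      = (\<Pi>\<^sub>M i\<in>{..<m}. distr N borel (\<lambda>\<omega>. W (ts (Suc i)) \<omega> - W (ts i) \<omega>))"
    using m by (subst (asm) indep_vars_iff_distr_eq_PiM) auto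
  also have "\<dots> = (\<Pi>\<^sub>M i\<in>{..<m}. density lborel (normal_density 0 (sqrt (1 / real m))))"
  proof (intro PiM_cong refl)
    fix i assume i: "i \<in> {..<m}"
    have "0 \<le> ts i \<and> ts i < ts (Suc i) \<and> ts (Suc i) \<le> 1"
      using i m by (auto simp: ts_def divide_strict_right_mono)
    then have "distributed N lborel (\<lambda>\<omega>. W (ts (Suc i)) \<omega> - W (ts i) \<omega>)
        (normal_density 0 (sqrt (ts (Suc i) - ts i)))"
      using W unfolding wiener01_def by blast
    moreover have "ts (Suc i) - ts i = 1 / real m"
      by (simp add: ts_def diff_divide_distrib[symmetric])
    ultimately have "distributed N lborel (\<lambda>\<omega>. W (ts (Suc i)) \<omega> - W (ts i) \<omega>) (normal_density 0 (sqrt (1 / real m)))"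
      by simp
    then have "distr N lborel (\<lambda>\<omega>. W (ts (Suc i)) \<omega> - W (ts i) \<omega>) = density lborel (normal_density 0 (sqrt (1 / real m)))"
      by (simp add: distributed_def)
    \<comment> \<open>\<open>distributed\<close> pushes forward to \<open>lborel\<close>, the
      product above to \<open>borel\<close>; the two have the same measurable sets.\<close>
    then show "distr N borel (\<lambda>\<omega>. W (ts (Suc i)) \<omega> - W (ts i) \<omega>) = density lborel (normal_density 0 (sqrt (1 / real m)))"
      by (subst distr_cong[of N N borel lborel]) auto
  qed
  finally show ?thesis unfolding ts_def .
qed

text \<open>Telescoping from \<open>x 0 = 0\<close> recovers the grid values. The increments are
  restricted to \<open>{..<m}\<close> so as to be points of the product space.\<close>

lemma bridge_grid_max_eq_increments:
  fixes x :: "real \<Rightarrow> real"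
  assumes "x 0 = 0" "m > 0"
  defines "v \<equiv> (\<lambda>i\<in>{..<m}. x (real (Suc i) / real m) - x (real i / real m))"
  shows "bridge_grid_max m x
       = Max ((\<lambda>k. \<bar>(\<Sum>i<k. v i) - real k / real m * (\<Sum>i<m. v i)\<bar>) ` {..m})"
proof -
  have tele: "(\<Sum>i<k. v i) = x (real k / real m)" if "k \<le> m" for k
  proof -
    have "(\<Sum>i<k. v i) = (\<Sum>i<k. x (real (Suc i) / real m) - x (real i / real m))"
      using that by (intro sum.cong) (auto simp: v_def)
    also have "\<dots> = x (real k / real m) - x (real 0 / real m)"
      by (rule sum_lessThan_telescope[of "\<lambda>i. x (real i / real m)"])
    finally show ?thesis using assms by simp
  qed
  have x1: "(\<Sum>i<m. v i) = x 1" using tele[OF order.refl] assms(2) by simp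
  have "(\<lambda>k. \<bar>x (real k / real m) - real k / real m * x 1\<bar>) ` {..m}
      = (\<lambda>k. \<bar>(\<Sum>i<k. v i) - real k / real m * (\<Sum>i<m. v i)\<bar>) ` {..m}"
    by (rule image_cong[OF refl]) (simp only: x1 tele atMost_iff)
  then show ?thesis unfolding bridge_grid_max_def by (rule arg_cong)
qed

lemma wiener01_bridge_grid_max_expectation:
  assumes "wiener01 N W" "wiener01 N' W'" and m: "m > 0"
    and "g \<in> borel_measurable (borel :: real measure)"
  shows "integral\<^sup>L N (\<lambda>\<omega>. g (bridge_grid_max m (\<lambda>t. W t \<omega>)) :: real)
       = integral\<^sup>L N' (\<lambda>\<omega>. g (bridge_grid_max m (\<lambda>t. W' t \<omega>)))"
proof -
  let ?P = "\<Pi>\<^sub>M i\<in>{..<m}. (borel :: real measure)"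
  define F where "F v = Max ((\<lambda>k. \<bar>(\<Sum>i<k. v i) - real k / real m * (\<Sum>i<m. v i)\<bar>) ` {..m})"
    for v :: "nat \<Rightarrow> real"
  have comp: "(\<lambda>v. \<bar>(\<Sum>i<k. v i) - real k / real m * (\<Sum>i<m. v i)\<bar>) \<in> borel_measurable ?P"
    if "k \<le> m" for k
  proof -
    have proj: "(\<lambda>v. v i) \<in> borel_measurable ?P" if "i < m" for i
      by (rule measurable_component_singleton) (use that in simp)
    have sums: "(\<lambda>v. \<Sum>i<j. v i) \<in> borel_measurable ?P" if "j \<le> m" for j
      by (rule borel_measurable_sum, rule proj) (use that in simp)
    show ?thesis
      by (intro borel_measurable_abs borel_measurable_diff borel_measurable_times borel_measurable_const
          sums order.refl that)
  qed
  have F: "F \<in> borel_measurable ?P"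
    unfolding F_def[abs_def] by (intro borel_measurable_Max comp) auto
  \<comment> \<open>The fact is polymorphic in the sample space, so it can be applied to
    \<open>N\<close> and \<open>N'\<close> of different types.\<close>
  have main: "integral\<^sup>L L (\<lambda>\<omega>. g (bridge_grid_max m (\<lambda>t. V t \<omega>)))
      = integral\<^sup>L (\<Pi>\<^sub>M i\<in>{..<m}. density lborel (normal_density 0 (sqrt (1 / real m)))) (\<lambda>v. g (F v))"
    if V: "wiener01 L V" for V and L :: "'z measure"
  proof -
    let ?X = "\<lambda>\<omega>. \<lambda>i\<in>{..<m}. V (real (Suc i) / real m) \<omega> - V (real i / real m) \<omega>"
    have [measurable]: "V t \<in> borel_measurable L" for t using V by (simp add: wiener01_def)
    have X: "?X \<in> measurable L ?P"
      by (intro measurable_restrict borel_measurable_diff) auto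
    have "integral\<^sup>L L (\<lambda>\<omega>. g (bridge_grid_max m (\<lambda>t. V t \<omega>))) = integral\<^sup>L L (\<lambda>\<omega>. g (F (?X \<omega>)))"
    proof (rule Bochner_Integration.integral_cong[OF refl])
      fix \<omega> assume "\<omega> \<in> space L"
      then have "V 0 \<omega> = 0" using V by (simp add: wiener01_def)
      then show "g (bridge_grid_max m (\<lambda>t. V t \<omega>)) = g (F (?X \<omega>))"
        unfolding F_def using m by (intro arg_cong[where f=g] bridge_grid_max_eq_increments)
    qed
    also have "\<dots> = integral\<^sup>L (distr L ?P ?X) (\<lambda>v. g (F v))"
      by (rule integral_distr[symmetric, OF X measurable_compose[OF F assms(4)]])
    finally show ?thesis unfolding wiener01_increments_distr[OF V m] .
  qed
  show ?thesis unfolding main[OF assms(1)] main[OF assms(2)] ..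
qed

lemma wiener01_bridge_sup_tendsto:
  fixes g :: "real \<Rightarrow> real"
  assumes W: "wiener01 N W" and g: "continuous_on UNIV g" and bound: "\<And>x. \<bar>g x\<bar> \<le> C"
  shows "(\<lambda>m. integral\<^sup>L N (\<lambda>\<omega>. g (bridge_grid_max (Suc m) (\<lambda>t. W t \<omega>))))
           \<longlonglongrightarrow> integral\<^sup>L N (\<lambda>\<omega>. g (bridge_sup (\<lambda>t. W t \<omega>)))"
proof (rule integral_dominated_convergence)
  interpret prob_space N using W by (simp add: wiener01_def)
  have Wm: "W t \<in> borel_measurable N" for t using W by (simp add: wiener01_def)
  have gm: "g \<in> borel_measurable borel" using g by (rule borel_measurable_continuous_onI)
  have cont: "continuous_on {0..1} (\<lambda>t. W t \<omega>)" if "\<omega> \<in> space N" for \<omega>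
    using W that by (simp add: wiener01_def)
  have "(\<lambda>\<omega>. bridge_sup (\<lambda>t. W t \<omega>)) \<in> borel_measurable N"
    by (rule measurable_bridge_sup) (auto intro: continuous_imp_cadlag01 cont Wm)
  then show "(\<lambda>\<omega>. g (bridge_sup (\<lambda>t. W t \<omega>))) \<in> borel_measurable N"
    by (rule measurable_compose[OF _ gm])
  show "(\<lambda>\<omega>. g (bridge_grid_max (Suc m) (\<lambda>t. W t \<omega>))) \<in> borel_measurable N" for m
  proof (rule measurable_compose[OF _ gm])
    have "(\<lambda>\<omega>. \<bar>W s \<omega> - s * W 1 \<omega>\<bar>) \<in> borel_measurable N" for s
      using Wm by measurable
    then show "(\<lambda>\<omega>. bridge_grid_max (Suc m) (\<lambda>t. W t \<omega>)) \<in> borel_measurable N"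
      unfolding bridge_grid_max_def by (rule borel_measurable_Max[OF finite_atMost])
  qed
  show "integrable N (\<lambda>_. C)" by simp
  show "AE \<omega> in N. (\<lambda>m. g (bridge_grid_max (Suc m) (\<lambda>t. W t \<omega>))) \<longlonglongrightarrow> g (bridge_sup (\<lambda>t. W t \<omega>))"
  proof (rule AE_I2)
    fix \<omega> assume "\<omega> \<in> space N"
    from bridge_grid_max_tendsto[OF cont[OF this]]
    show "(\<lambda>m. g (bridge_grid_max (Suc m) (\<lambda>t. W t \<omega>))) \<longlonglongrightarrow> g (bridge_sup (\<lambda>t. W t \<omega>))"
      using continuous_on_tendsto_compose[OF g] by simp
  qed
  show "AE \<omega> in N. norm (g (bridge_grid_max (Suc m) (\<lambda>t. W t \<omega>))) \<le> C" for m
    using bound by simp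
qed

text \<open>This identifies the limit obtained from the Wiener process of hypothesis (a) with the
  law of the bridge in the conclusion.\<close>

lemma wiener01_bridge_sup_expectation:
  fixes g :: "real \<Rightarrow> real"
  assumes "wiener01 N W" "wiener01 N' W'" "continuous_on UNIV g" "\<And>x. \<bar>g x\<bar> \<le> C"
  shows "integral\<^sup>L N (\<lambda>\<omega>. g (bridge_sup (\<lambda>t. W t \<omega>))) = integral\<^sup>L N' (\<lambda>\<omega>. g (bridge_sup (\<lambda>t. W' t \<omega>)))"
proof (rule LIMSEQ_unique)
  have "g \<in> borel_measurable borel" using assms(3) by (rule borel_measurable_continuous_onI)
  from wiener01_bridge_grid_max_expectation[OF assms(1,2) zero_less_Suc this]
  show "(\<lambda>m. integral\<^sup>L N (\<lambda>\<omega>. g (bridge_grid_max (Suc m) (\<lambda>t. W t \<omega>))))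
           \<longlonglongrightarrow> integral\<^sup>L N' (\<lambda>\<omega>. g (bridge_sup (\<lambda>t. W' t \<omega>)))"
    using wiener01_bridge_sup_tendsto[OF assms(2-4)] by simp
qed (rule wiener01_bridge_sup_tendsto[OF assms(1,3,4)])

section \<open>Weak convergence criteria\<close>

lemma continuous_on_cts_step: "a < b \<Longrightarrow> continuous_on UNIV (cts_step a b)"
  by (intro uniformly_continuous_imp_continuous cts_step_uniformly_continuous)

lemma cts_step_bounded: "a < b \<Longrightarrow> \<bar>cts_step a b x\<bar> \<le> 1"
  by (auto simp: cts_step_def divide_simps)

text \<open>
  A form of Slutsky's theorem: comparing distribution functions at \<open>x\<close> and \<open>x \<plusminus> d\<close> on events of
  probability tending to one dispenses with tightness of the sequence.
\<close>
lemma weak_conv_m_sandwich: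
  fixes T A :: "nat \<Rightarrow> 'a \<Rightarrow> real" and L :: "'b \<Rightarrow> real"
  assumes M: "prob_space M" and N: "prob_space N"
    and T: "\<And>n. T n \<in> borel_measurable M" and A: "\<And>n. A n \<in> borel_measurable M"
    and L: "L \<in> borel_measurable N"
    and conv: "\<And>a b. a < b \<Longrightarrow> (\<lambda>n. integral\<^sup>L M (\<lambda>\<omega>. cts_step a b (A n \<omega>))) \<longlonglongrightarrow> integral\<^sup>L N (\<lambda>\<omega>. cts_step a b (L \<omega>))"
    and close: "\<And>x d. d > 0 \<Longrightarrow> \<exists>G. (\<forall>n. G n \<in> sets M) \<and> (\<lambda>n. measure M (space M - G n)) \<longlonglongrightarrow> 0 \<and>
        (\<forall>\<^sub>F n in sequentially. \<forall>\<omega>\<in>G n. (T n \<omega> \<le> x \<longrightarrow> A n \<omega> \<le> x + d) \<and> (A n \<omega> \<le> x - d \<longrightarrow> T n \<omega> \<le> x))"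
  shows "weak_conv_m (\<lambda>n. distr M borel (T n)) (distr N borel L)"
  unfolding weak_conv_m_def weak_conv_def
proof (intro allI impI)
  interpret M: prob_space M by (rule M)
  interpret N: prob_space N by (rule N)
  interpret DN: real_distribution "distr N borel L" using L by (rule N.real_distribution_distr)
  have DA: "real_distribution (distr M borel (A n))" for n using A by (rule M.real_distribution_distr)
  let ?F = "cdf (distr N borel L)"
  fix x assume cont: "isCont ?F x"
  have cdfT: "cdf (distr M borel (T n)) y = M.prob {\<omega>\<in>space M. T n \<omega> \<le> y}" for n y
    unfolding cdf_def using T by (subst measure_distr) (auto intro!: arg_cong[where f="M.prob"])
  have cdfA: "cdf (distr M borel (A n)) y = M.prob {\<omega>\<in>space M. A n \<omega> \<le> y}" for n y
    unfolding cdf_def using A by (subst measure_distr) (auto intro!: arg_cong[where f="M.prob"])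
  have step_m: "cts_step a b \<in> borel_measurable borel" if "a < b" for a b
    using continuous_on_cts_step[OF that] by (rule borel_measurable_continuous_onI)
  have stepA: "integral\<^sup>L (distr M borel (A n)) (cts_step a b) = integral\<^sup>L M (\<lambda>\<omega>. cts_step a b (A n \<omega>))"
    if "a < b" for n a b using A step_m[OF that] by (rule integral_distr)
  have stepN: "integral\<^sup>L (distr N borel L) (cts_step a b) = integral\<^sup>L N (\<lambda>\<omega>. cts_step a b (L \<omega>))"
    if "a < b" for a b using L step_m[OF that] by (rule integral_distr)
  have ms: "{\<omega>\<in>space M. T n \<omega> \<le> y} \<in> sets M" "{\<omega>\<in>space M. A n \<omega> \<le> y} \<in> sets M" for n y
    using T A by measurable
  show "(\<lambda>n. cdf (distr M borel (T n)) x) \<longlonglongrightarrow> ?F x"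
  proof (rule tendstoI)
    fix e :: real assume e: "e > 0"
    have "eventually (\<lambda>y. dist (?F y) (?F x) < e / 3) (at x)"
      using cont e unfolding isCont_def by (intro tendstoD) auto
    then obtain r where r: "r > 0" "\<And>y. y \<noteq> x \<Longrightarrow> dist y x < r \<Longrightarrow> dist (?F y) (?F x) < e / 3"
      unfolding eventually_at by blast
    \<comment> \<open>From \<open>x\<close> to \<open>x + 2 * d\<close> one \<open>d\<close> is
      spent on the closeness of \<open>T\<close> and \<open>A\<close>, the other on the width of the
      continuous step; both ends stay within \<open>r\<close> of \<open>x\<close>.\<close>
    define d where "d = r / 3"
    have d: "d > 0" using r by (simp add: d_def)
    have "dist (?F (x + 2 * d)) (?F x) < e / 3" "dist (?F (x - 2 * d)) (?F x) < e / 3"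
      using r(1) by (intro r(2); simp add: d_def dist_real_def)+
    then have Fu: "?F (x + 2 * d) < ?F x + e / 3" and Fl: "?F (x - 2 * d) > ?F x - e / 3"
      unfolding dist_real_def by linarith+
    obtain G where G: "\<And>n. G n \<in> sets M" "(\<lambda>n. measure M (space M - G n)) \<longlonglongrightarrow> 0"
      "\<forall>\<^sub>F n in sequentially. \<forall>\<omega>\<in>G n. (T n \<omega> \<le> x \<longrightarrow> A n \<omega> \<le> x + d) \<and> (A n \<omega> \<le> x - d \<longrightarrow> T n \<omega> \<le> x)"
      using close[OF d, of x] by blast
    \<comment> \<open>The step function of \<open>?u\<close> lies between the indicators of
      \<open>A n \<le> x + d\<close> and \<open>A n \<le> x + 2 * d\<close>; \<open>?l\<close> is
      placed likewise below \<open>x\<close>.\<close>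
    let ?u = "\<lambda>n. integral\<^sup>L M (\<lambda>\<omega>. cts_step (x + d) (x + 2 * d) (A n \<omega>))"
    let ?l = "\<lambda>n. integral\<^sup>L M (\<lambda>\<omega>. cts_step (x - 2 * d) (x - d) (A n \<omega>))"
    have du: "x + d < x + 2 * d" and dl: "x - 2 * d < x - d" using d by auto
    have "integral\<^sup>L N (\<lambda>\<omega>. cts_step (x + d) (x + 2 * d) (L \<omega>)) \<le> ?F (x + 2 * d)"
      using DN.cdf_cts_step(2)[OF du] stepN[OF du] by simp
    then have eu: "\<forall>\<^sub>F n in sequentially. ?u n < ?F x + e / 3"
      using Fu by (intro order_tendstoD(2)[OF conv[OF du]]) auto
    have "?F (x - 2 * d) \<le> integral\<^sup>L N (\<lambda>\<omega>. cts_step (x - 2 * d) (x - d) (L \<omega>))"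
      using DN.cdf_cts_step(1)[OF dl] stepN[OF dl] by simp
    then have el: "\<forall>\<^sub>F n in sequentially. ?l n > ?F x - e / 3"
      using Fl by (intro order_tendstoD(1)[OF conv[OF dl]]) auto
    have eG: "\<forall>\<^sub>F n in sequentially. measure M (space M - G n) < e / 3"
      using e by (intro order_tendstoD(2)[OF G(2)]) auto
    show "\<forall>\<^sub>F n in sequentially. dist (cdf (distr M borel (T n)) x) (?F x) < e"
      using eu el eG G(3)
    proof eventually_elim
      case (elim n)
      have "M.prob {\<omega>\<in>space M. T n \<omega> \<le> x} \<le> M.prob ({\<omega>\<in>space M. A n \<omega> \<le> x + d} \<union> (space M - G n))"
        using elim(4) ms G(1) by (intro M.finite_measure_mono) auto
      also have "\<dots> \<le> M.prob {\<omega>\<in>space M. A n \<omega> \<le> x + d} + M.prob (space M - G n)"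
        using ms G(1) by (intro measure_Un_le) auto
      also have "M.prob {\<omega>\<in>space M. A n \<omega> \<le> x + d} \<le> ?u n"
        using real_distribution.cdf_cts_step(1)[OF DA du, of n] stepA[OF du] cdfA by simp
      finally have 1: "M.prob {\<omega>\<in>space M. T n \<omega> \<le> x} < ?F x + e" using elim e by simp
      have "?l n \<le> M.prob {\<omega>\<in>space M. A n \<omega> \<le> x - d}"
        using real_distribution.cdf_cts_step(2)[OF DA dl, of n] stepA[OF dl] cdfA by simp
      also have "\<dots> \<le> M.prob ({\<omega>\<in>space M. T n \<omega> \<le> x} \<union> (space M - G n))"
        using elim(4) ms G(1) by (intro M.finite_measure_mono) auto
      also have "\<dots> \<le> M.prob {\<omega>\<in>space M. T n \<omega> \<le> x} + M.prob (space M - G n)"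
        using ms G(1) by (intro measure_Un_le) auto
      finally have 2: "M.prob {\<omega>\<in>space M. T n \<omega> \<le> x} > ?F x - e" using elim e by simp
      show ?case using 1 2 by (simp add: cdfT dist_real_def abs_less_iff)
    qed
  qed
qed

section \<open>Convergence of second moments by truncation\<close>

text \<open>Truncation matters only where the square exceeds \<open>K\<close>, and there the square
  is at most the fourth power divided by \<open>K\<close>. A bound on fourth moments thus makes the
  error uniform.\<close>

lemma truncated_square_error:
  fixes X :: "'a \<Rightarrow> real"
  assumes "prob_space M" and [measurable]: "X \<in> borel_measurable M"
    and X4: "integrable M (\<lambda>\<omega>. X \<omega> ^ 4)" "integral\<^sup>L M (\<lambda>\<omega>. X \<omega> ^ 4) \<le> C" and K: "K > 0"
  shows "\<bar>integral\<^sup>L M (\<lambda>\<omega>. (X \<omega>)\<^sup>2) - integral\<^sup>L M (\<lambda>\<omega>. min ((X \<omega>)\<^sup>2) K)\<bar> \<le> C / K"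
proof -
  interpret prob_space M by fact
  have sq: "x\<^sup>2 \<le> 1 + x ^ 4" for x :: real
  proof -
    have "0 \<le> (x\<^sup>2 - 1/2)\<^sup>2" by simp
    also have "\<dots> = x ^ 4 - x\<^sup>2 + 1/4" by (simp add: power2_eq_square power4_eq_xxxx algebra_simps)
    finally show ?thesis by simp
  qed
  have X2: "integrable M (\<lambda>\<omega>. (X \<omega>)\<^sup>2)"
    by (rule Bochner_Integration.integrable_bound[of _ "\<lambda>\<omega>. 1 + X \<omega> ^ 4"]) (use X4 sq in \<open>auto intro: order_trans\<close>)
  have Xm: "integrable M (\<lambda>\<omega>. min ((X \<omega>)\<^sup>2) K)"
    by (rule Bochner_Integration.integrable_bound[OF X2]) (use K in auto)
  have err: "\<bar>x\<^sup>2 - min (x\<^sup>2) K\<bar> \<le> x ^ 4 / K" for x :: real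
  proof (cases "x\<^sup>2 \<le> K")
    case False
    then have "K * x\<^sup>2 \<le> x\<^sup>2 * x\<^sup>2" by (intro mult_right_mono) auto
    then have "x\<^sup>2 \<le> x ^ 4 / K" using K by (simp add: field_simps power2_eq_square power4_eq_xxxx)
    with False K show ?thesis by simp
  qed (use K in simp)
  have "\<bar>integral\<^sup>L M (\<lambda>\<omega>. (X \<omega>)\<^sup>2) - integral\<^sup>L M (\<lambda>\<omega>. min ((X \<omega>)\<^sup>2) K)\<bar>
      = \<bar>integral\<^sup>L M (\<lambda>\<omega>. (X \<omega>)\<^sup>2 - min ((X \<omega>)\<^sup>2) K)\<bar>" using X2 Xm by simp
  also have "\<dots> \<le> integral\<^sup>L M (\<lambda>\<omega>. \<bar>(X \<omega>)\<^sup>2 - min ((X \<omega>)\<^sup>2) K\<bar>)"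
    by (rule integral_abs_bound)
  also have "\<dots> \<le> integral\<^sup>L M (\<lambda>\<omega>. X \<omega> ^ 4 / K)"
    using X2 Xm X4 err by (intro integral_mono) auto
  also have "\<dots> \<le> C / K" using X4 K by (simp add: divide_right_mono)
  finally show ?thesis .
qed

lemma second_moment_tendsto:
  fixes X :: "nat \<Rightarrow> 'a \<Rightarrow> real" and Z :: "'b \<Rightarrow> real"
  assumes "prob_space M" "prob_space N"
    and "\<And>n. X n \<in> borel_measurable M" "\<And>n. integrable M (\<lambda>\<omega>. X n \<omega> ^ 4)" "\<And>n. integral\<^sup>L M (\<lambda>\<omega>. X n \<omega> ^ 4) \<le> C"
    and "Z \<in> borel_measurable N" "integrable N (\<lambda>\<omega>. Z \<omega> ^ 4)"
    and conv: "\<And>K. K > 0 \<Longrightarrow> (\<lambda>n. integral\<^sup>L M (\<lambda>\<omega>. min ((X n \<omega>)\<^sup>2) K)) \<longlonglongrightarrow> integral\<^sup>L N (\<lambda>\<omega>. min ((Z \<omega>)\<^sup>2) K)"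
  shows "(\<lambda>n. integral\<^sup>L M (\<lambda>\<omega>. (X n \<omega>)\<^sup>2)) \<longlonglongrightarrow> integral\<^sup>L N (\<lambda>\<omega>. (Z \<omega>)\<^sup>2)"
proof (rule tendstoI)
  fix e :: real assume e: "e > 0"
  define D where "D = integral\<^sup>L N (\<lambda>\<omega>. Z \<omega> ^ 4)"
  have "0 \<le> integral\<^sup>L M (\<lambda>\<omega>. X 0 \<omega> ^ 4)" "0 \<le> D" unfolding D_def by simp_all
  then have C: "0 \<le> C" and D: "0 \<le> D" using order.trans[OF _ assms(5)[of 0]] by blast+
  \<comment> \<open>Chosen to make the truncation errors of the sequence and of the limit at most
    \<open>e / 4\<close> each; the summand 1 keeps \<open>K\<close> positive.\<close>
  define K where "K = 4 * (C + D + 1) / e"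
  have K: "K > 0" using C D e by (simp add: K_def)
  have "C / K \<le> e / 4" "D / K \<le> e / 4"
    using C D e by (simp_all add: K_def field_simps)
  moreover have "\<forall>\<^sub>F n in sequentially. dist (integral\<^sup>L M (\<lambda>\<omega>. min ((X n \<omega>)\<^sup>2) K)) (integral\<^sup>L N (\<lambda>\<omega>. min ((Z \<omega>)\<^sup>2) K)) < e / 4"
    using e by (intro tendstoD[OF conv[OF K]]) auto
  ultimately show "\<forall>\<^sub>F n in sequentially. dist (integral\<^sup>L M (\<lambda>\<omega>. (X n \<omega>)\<^sup>2)) (integral\<^sup>L N (\<lambda>\<omega>. (Z \<omega>)\<^sup>2)) < e"
  proof (elim eventually_mono)
    fix n assume "dist (integral\<^sup>L M (\<lambda>\<omega>. min ((X n \<omega>)\<^sup>2) K)) (integral\<^sup>L N (\<lambda>\<omega>. min ((Z \<omega>)\<^sup>2) K)) < e / 4"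
      "C / K \<le> e / 4" "D / K \<le> e / 4"
    moreover have "\<bar>integral\<^sup>L N (\<lambda>\<omega>. (Z \<omega>)\<^sup>2) - integral\<^sup>L N (\<lambda>\<omega>. min ((Z \<omega>)\<^sup>2) K)\<bar> \<le> D / K"
      by (rule truncated_square_error[OF assms(2,6,7) _ K]) (simp add: D_def)
    moreover note truncated_square_error[OF assms(1,3,4,5) K, of n]
    ultimately show "dist (integral\<^sup>L M (\<lambda>\<omega>. (X n \<omega>)\<^sup>2)) (integral\<^sup>L N (\<lambda>\<omega>. (Z \<omega>)\<^sup>2)) < e"
      unfolding dist_real_def using e by linarith
  qed
qed

section \<open>Moments of linear and quadratic forms\<close>

locale summable_cumulants = prob_space M for M :: "'a measure" +
  fixes Y :: "int \<Rightarrow> 'a \<Rightarrow> real" and C :: real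
  assumes stationary: "fourth_order_stationary M Y"
    and mean_zero: "\<And>k. expectation (Y k) = 0"
    and autocov_summable: "(\<lambda>j. \<bar>autocov M Y j\<bar>) summable_on UNIV"
    and cum4_summable: "\<And>h. (\<lambda>(r, s). \<bar>cum4 M Y h r s\<bar>) summable_on UNIV"
    and cum4_bound: "\<And>h. (\<Sum>\<^sub>\<infinity>(r, s). \<bar>cum4 M Y h r s\<bar>) \<le> C"
begin

abbreviation \<gamma> :: "int \<Rightarrow> real" where "\<gamma> \<equiv> autocov M Y"

definition \<Gamma> :: real where "\<Gamma> = (\<Sum>\<^sub>\<infinity>j. \<bar>\<gamma> j\<bar>)"

abbreviation y :: "nat \<Rightarrow> 'a \<Rightarrow> real" where "y i \<equiv> Y (int i)"

lemma measurable_Y [measurable]: "Y k \<in> borel_measurable M"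
  using stationary by (simp add: fourth_order_stationary_def)

lemma shift_moment:
  "length is \<le> 4 \<Longrightarrow> expectation (\<lambda>\<omega>. \<Prod>i\<leftarrow>is. Y (k + i) \<omega>) = expectation (\<lambda>\<omega>. \<Prod>i\<leftarrow>is. Y i \<omega>)"
  using stationary by (simp add: fourth_order_stationary_def)

text \<open>The elementary bound \<open>\<bar>u * v\<bar> \<le> u^2 + v^2\<close> is used twice,
  first for the two pair products and then for the squares inside each pair.\<close>

lemma integrable_prod4: "integrable M (\<lambda>\<omega>. Y i \<omega> * Y k \<omega> * (Y l \<omega> * Y m \<omega>))"
proof (rule Bochner_Integration.integrable_bound)
  show "integrable M (\<lambda>\<omega>. Y i \<omega> ^ 4 + Y k \<omega> ^ 4 + Y l \<omega> ^ 4 + Y m \<omega> ^ 4)"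
    using stationary by (simp add: fourth_order_stationary_def)
  have "\<bar>a * b * (c * d)\<bar> \<le> a ^ 4 + b ^ 4 + c ^ 4 + d ^ 4" for a b c d :: real
  proof -
    have am: "\<bar>u * v\<bar> \<le> u\<^sup>2 + v\<^sup>2" for u v :: real
    proof -
      have "2 * \<bar>u\<bar> * \<bar>v\<bar> \<le> u\<^sup>2 + v\<^sup>2" using sum_squares_bound[of "\<bar>u\<bar>" "\<bar>v\<bar>"] by simp
      moreover have "0 \<le> \<bar>u\<bar> * \<bar>v\<bar>" by simp
      ultimately show ?thesis unfolding abs_mult by linarith
    qed
    have am2: "(u * v)\<^sup>2 \<le> u ^ 4 + v ^ 4" for u v :: real
      using am[of "u\<^sup>2" "v\<^sup>2"] by (simp add: power_mult_distrib flip: power_mult)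
    show ?thesis using am[of "a * b" "c * d"] am2[of a b] am2[of c d] by linarith
  qed
  then show "AE \<omega> in M. norm (Y i \<omega> * Y k \<omega> * (Y l \<omega> * Y m \<omega>))
      \<le> norm (Y i \<omega> ^ 4 + Y k \<omega> ^ 4 + Y l \<omega> ^ 4 + Y m \<omega> ^ 4)"
    by (auto intro!: AE_I2 order_trans[OF _ abs_ge_self])
qed simp

lemma integrable_prod2: "integrable M (\<lambda>\<omega>. Y i \<omega> * Y k \<omega>)"
proof (rule Bochner_Integration.integrable_bound)
  show "integrable M (\<lambda>\<omega>. 1 + Y i \<omega> * Y k \<omega> * (Y i \<omega> * Y k \<omega>))"
    using integrable_prod4 by simp
  have "\<bar>a\<bar> \<le> 1 + a * a" for a :: real
    using sum_squares_bound[of 1 "\<bar>a\<bar>"] by (simp add: power2_eq_square)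
  then show "AE \<omega> in M. norm (Y i \<omega> * Y k \<omega>) \<le> norm (1 + Y i \<omega> * Y k \<omega> * (Y i \<omega> * Y k \<omega>))"
    by (auto intro!: AE_I2 order_trans[OF _ abs_ge_self])
qed simp

lemma expectation_prod2: "expectation (\<lambda>\<omega>. Y i \<omega> * Y k \<omega>) = \<gamma> (k - i)"
  using shift_moment[of "[0, k - i]" i] by (simp add: autocov_def mean_zero)

lemma expectation_prod4:
  "expectation (\<lambda>\<omega>. Y i \<omega> * Y k \<omega> * (Y l \<omega> * Y m \<omega>)) =
     cum4 M Y (k - i) (l - i) (m - i) + \<gamma> (k - i) * \<gamma> (l - m) + \<gamma> (l - i) * \<gamma> (k - m) + \<gamma> (m - i) * \<gamma> (k - l)"
  using shift_moment[of "[0, k - i, l - i, m - i]" i] by (simp add: cum4_def mult.assoc)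

lemma autocov_minus: "\<gamma> (k - i) = \<gamma> (i - k)"
  unfolding expectation_prod2[symmetric] by (simp add: mult.commute)

lemma sum_autocov_le:
  assumes "finite A" "inj_on f A"
  shows "(\<Sum>l\<in>A. \<bar>\<gamma> (f l)\<bar>) \<le> \<Gamma>"
proof -
  have "(\<Sum>l\<in>A. \<bar>\<gamma> (f l)\<bar>) = (\<Sum>j\<in>f ` A. \<bar>\<gamma> j\<bar>)"
    using assms(2) by (simp add: sum.reindex)
  also have "\<dots> \<le> \<Gamma>" unfolding \<Gamma>_def
    using assms(1) by (intro finite_sum_le_infsum autocov_summable) auto
  finally show ?thesis .
qed

lemma \<Gamma>_nonneg: "0 \<le> \<Gamma>" using sum_autocov_le[of "{}"] by simp

lemma sum_cum4_le:
  assumes "finite A" "inj_on f A"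
  shows "(\<Sum>p\<in>A. \<bar>cum4 M Y h (fst (f p)) (snd (f p))\<bar>) \<le> C"
proof -
  have "(\<Sum>p\<in>A. \<bar>cum4 M Y h (fst (f p)) (snd (f p))\<bar>) = (\<Sum>(r, s)\<in>f ` A. \<bar>cum4 M Y h r s\<bar>)"
    using assms(2) by (simp add: sum.reindex case_prod_beta)
  also have "\<dots> \<le> (\<Sum>\<^sub>\<infinity>(r, s). \<bar>cum4 M Y h r s\<bar>)"
    using assms(1) by (intro finite_sum_le_infsum cum4_summable) auto
  also have "\<dots> \<le> C" by (rule cum4_bound)
  finally show ?thesis .
qed

lemma C_nonneg: "0 \<le> C" using sum_cum4_le[of "{}"] by simp

text \<open>For fixed \<open>i\<close> the lags \<open>k - i\<close> are distinct, so each row of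
  the double sum is at most \<open>A^2 * \<Gamma>\<close>. Constant coefficients give the partial
  sums, row sums of the kernel give the linear form left over by centring.\<close>

lemma linear_form_second_moment:
  assumes I: "finite I" and a: "\<And>i. i \<in> I \<Longrightarrow> \<bar>a i\<bar> \<le> A"
  shows "integrable M (\<lambda>\<omega>. (\<Sum>i\<in>I. a i * y i \<omega>)\<^sup>2)"
    and "expectation (\<lambda>\<omega>. (\<Sum>i\<in>I. a i * y i \<omega>)\<^sup>2) \<le> A\<^sup>2 * real (card I) * \<Gamma>"
proof -
  have sq: "(\<Sum>i\<in>I. a i * y i \<omega>)\<^sup>2 = (\<Sum>i\<in>I. \<Sum>k\<in>I. a i * a k * (y i \<omega> * y k \<omega>))" for \<omega>
    unfolding power2_eq_square sum_product by (intro sum.cong) (auto simp: algebra_simps)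
  show "integrable M (\<lambda>\<omega>. (\<Sum>i\<in>I. a i * y i \<omega>)\<^sup>2)"
    unfolding sq by (intro Bochner_Integration.integrable_sum integrable_mult_right integrable_prod2)
  have "expectation (\<lambda>\<omega>. (\<Sum>i\<in>I. a i * y i \<omega>)\<^sup>2) = (\<Sum>i\<in>I. \<Sum>k\<in>I. a i * a k * \<gamma> (int k - int i))"
    unfolding sq
    by (simp add: Bochner_Integration.integral_sum Bochner_Integration.integrable_sum integrable_prod2 expectation_prod2)
  also have "\<dots> \<le> (\<Sum>i\<in>I. A\<^sup>2 * \<Gamma>)"
  proof (rule sum_mono)
    fix i assume i: "i \<in> I"
    have "(\<Sum>k\<in>I. a i * a k * \<gamma> (int k - int i)) \<le> (\<Sum>k\<in>I. A\<^sup>2 * \<bar>\<gamma> (int k - int i)\<bar>)"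
    proof (rule sum_mono)
      fix k assume k: "k \<in> I"
      have "\<bar>a i * a k\<bar> \<le> A\<^sup>2"
        unfolding abs_mult power2_eq_square using a[OF i] a[OF k] by (intro mult_mono) auto
      then have "\<bar>a i * a k * \<gamma> (int k - int i)\<bar> \<le> A\<^sup>2 * \<bar>\<gamma> (int k - int i)\<bar>"
        unfolding abs_mult[of "a i * a k"] by (intro mult_right_mono) auto
      then show "a i * a k * \<gamma> (int k - int i) \<le> A\<^sup>2 * \<bar>\<gamma> (int k - int i)\<bar>" by linarith
    qed
    also have "\<dots> \<le> A\<^sup>2 * \<Gamma>"
      unfolding sum_distrib_left[symmetric] using I
      by (intro mult_left_mono sum_autocov_le) (auto simp: inj_on_def)
    finally show "(\<Sum>k\<in>I. a i * a k * \<gamma> (int k - int i)) \<le> A\<^sup>2 * \<Gamma>" .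
  qed
  finally show "expectation (\<lambda>\<omega>. (\<Sum>i\<in>I. a i * y i \<omega>)\<^sup>2) \<le> A\<^sup>2 * real (card I) * \<Gamma>"
    by (simp add: algebra_simps)
qed

definition pair_dev :: "nat \<times> nat \<Rightarrow> 'a \<Rightarrow> real" where
  "pair_dev p \<omega> = y (fst p) \<omega> * y (snd p) \<omega> - \<gamma> (int (snd p) - int (fst p))"

text \<open>Of the three Gaussian pairings in the fourth moment, centring removes the one joining
  \<open>i\<close> to \<open>k\<close> and \<open>l\<close> to \<open>m\<close>. That one does not
  decay as the pairs move apart; the two that remain do.\<close>

lemma
  shows integrable_pair_dev_mult: "integrable M (\<lambda>\<omega>. pair_dev (i, k) \<omega> * pair_dev (l, m) \<omega>)"
    and expectation_pair_dev_mult: "expectation (\<lambda>\<omega>. pair_dev (i, k) \<omega> * pair_dev (l, m) \<omega>) =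
      cum4 M Y (int k - int i) (int l - int i) (int m - int i)
      + \<gamma> (int l - int i) * \<gamma> (int m - int k) + \<gamma> (int m - int i) * \<gamma> (int l - int k)"
proof -
  let ?g = "\<gamma> (int k - int i)" and ?h = "\<gamma> (int m - int l)"
  have eq: "pair_dev (i, k) \<omega> * pair_dev (l, m) \<omega>
      = y i \<omega> * y k \<omega> * (y l \<omega> * y m \<omega>) - ?h * (y i \<omega> * y k \<omega>) - ?g * (y l \<omega> * y m \<omega>) + ?g * ?h" for \<omega>
    by (simp add: pair_dev_def algebra_simps)
  show "integrable M (\<lambda>\<omega>. pair_dev (i, k) \<omega> * pair_dev (l, m) \<omega>)"
    unfolding eq
    by (intro Bochner_Integration.integrable_add Bochner_Integration.integrable_diff
        integrable_mult_right integrable_prod2 integrable_prod4) simp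
  have "expectation (\<lambda>\<omega>. pair_dev (i, k) \<omega> * pair_dev (l, m) \<omega>)
      = expectation (\<lambda>\<omega>. y i \<omega> * y k \<omega> * (y l \<omega> * y m \<omega>)) - ?h * ?g - ?g * ?h + ?g * ?h"
    unfolding eq
    by (simp add: integrable_prod2 integrable_prod4 expectation_prod2 prob_space)
  then show "expectation (\<lambda>\<omega>. pair_dev (i, k) \<omega> * pair_dev (l, m) \<omega>) =
      cum4 M Y (int k - int i) (int l - int i) (int m - int i)
      + \<gamma> (int l - int i) * \<gamma> (int m - int k) + \<gamma> (int m - int i) * \<gamma> (int l - int k)"
    unfolding expectation_prod4
    using autocov_minus[of "int m" "int l"] autocov_minus[of "int m" "int k"] autocov_minus[of "int l" "int k"]
    by simp
qed

text \<open>Enlarging \<open>P\<close> to the product of its projections lets the double sum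
  factor.\<close>

lemma sum_autocov_mult_le:
  assumes P: "finite P"
  shows "(\<Sum>p\<in>P. \<bar>\<gamma> (int (fst p) - i) * \<gamma> (int (snd p) - k)\<bar>) \<le> \<Gamma>\<^sup>2"
proof -
  have fin: "finite (fst ` P)" "finite (snd ` P)" using P by auto
  have "(\<Sum>p\<in>P. \<bar>\<gamma> (int (fst p) - i) * \<gamma> (int (snd p) - k)\<bar>)
      \<le> (\<Sum>p\<in>fst ` P \<times> snd ` P. \<bar>\<gamma> (int (fst p) - i) * \<gamma> (int (snd p) - k)\<bar>)"
    using fin by (intro sum_mono2) (auto intro: rev_image_eqI)
  also have "\<dots> = (\<Sum>l\<in>fst ` P. \<bar>\<gamma> (int l - i)\<bar>) * (\<Sum>m\<in>snd ` P. \<bar>\<gamma> (int m - k)\<bar>)"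
    by (simp add: sum_product sum.cartesian_product abs_mult case_prod_beta)
  also have "\<dots> \<le> \<Gamma> * \<Gamma>"
    using fin \<Gamma>_nonneg by (intro mult_mono sum_autocov_le sum_nonneg) (auto simp: inj_on_def)
  finally show ?thesis by (simp add: power2_eq_square)
qed

text \<open>For a fixed pair \<open>(i, k)\<close> the covariances with all other pairs sum to at
  most \<open>2 * \<Gamma>^2 + C\<close>: the cumulant has its first lag frozen at
  \<open>k - i\<close> while the other two vary, and each cross pairing contributes
  \<open>\<Gamma>^2\<close>. Hence the bound is linear in \<open>card P\<close>, not
  quadratic.\<close>

lemma quadratic_form_variance:
  assumes P: "finite P" and w: "\<And>p. p \<in> P \<Longrightarrow> \<bar>w p\<bar> \<le> 1"
  shows "integrable M (\<lambda>\<omega>. (\<Sum>p\<in>P. w p * pair_dev p \<omega>)\<^sup>2)"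
    and "expectation (\<lambda>\<omega>. (\<Sum>p\<in>P. w p * pair_dev p \<omega>)\<^sup>2) \<le> real (card P) * (2 * \<Gamma>\<^sup>2 + C)"
proof -
  have sq: "(\<Sum>p\<in>P. w p * pair_dev p \<omega>)\<^sup>2 = (\<Sum>p\<in>P. \<Sum>p'\<in>P. w p * w p' * (pair_dev p \<omega> * pair_dev p' \<omega>))" for \<omega>
    unfolding power2_eq_square sum_product by (intro sum.cong) (auto simp: algebra_simps)
  have int: "integrable M (\<lambda>\<omega>. pair_dev p \<omega> * pair_dev p' \<omega>)" for p p'
    using integrable_pair_dev_mult[of "fst p" "snd p" "fst p'" "snd p'"] by simp
  show "integrable M (\<lambda>\<omega>. (\<Sum>p\<in>P. w p * pair_dev p \<omega>)\<^sup>2)"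
    unfolding sq by (intro Bochner_Integration.integrable_sum integrable_mult_right int)
  have "expectation (\<lambda>\<omega>. (\<Sum>p\<in>P. w p * pair_dev p \<omega>)\<^sup>2)
      = (\<Sum>p\<in>P. \<Sum>p'\<in>P. w p * w p' * expectation (\<lambda>\<omega>. pair_dev p \<omega> * pair_dev p' \<omega>))"
    unfolding sq
    by (simp add: Bochner_Integration.integral_sum Bochner_Integration.integrable_sum int)
  also have "\<dots> \<le> (\<Sum>p\<in>P. 2 * \<Gamma>\<^sup>2 + C)"
  proof (rule sum_mono)
    fix p assume p: "p \<in> P"
    obtain i k where ik: "p = (i, k)" by (cases p)
    let ?K = "\<lambda>p'. \<bar>cum4 M Y (int k - int i) (int (fst p') - int i) (int (snd p') - int i)\<bar>"
    let ?A = "\<lambda>p'. \<bar>\<gamma> (int (fst p') - int i) * \<gamma> (int (snd p') - int k)\<bar>"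
    let ?B = "\<lambda>p'. \<bar>\<gamma> (int (fst p') - int k) * \<gamma> (int (snd p') - int i)\<bar>"
    have "(\<Sum>p'\<in>P. w p * w p' * expectation (\<lambda>\<omega>. pair_dev p \<omega> * pair_dev p' \<omega>)) \<le> (\<Sum>p'\<in>P. ?K p' + ?A p' + ?B p')"
    proof (rule sum_mono)
      fix p' assume p': "p' \<in> P"
      let ?E = "expectation (\<lambda>\<omega>. pair_dev p \<omega> * pair_dev p' \<omega>)"
      have "\<bar>w p * w p'\<bar> \<le> 1 * 1"
        unfolding abs_mult using w[OF p] w[OF p'] by (intro mult_mono) auto
      then have "\<bar>w p * w p' * ?E\<bar> \<le> 1 * \<bar>?E\<bar>"
        unfolding abs_mult[of "w p * w p'"] by (intro mult_right_mono) auto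
      moreover have "\<bar>?E\<bar> \<le> ?K p' + ?A p' + ?B p'"
      proof -
        have "?E = cum4 M Y (int k - int i) (int (fst p') - int i) (int (snd p') - int i)
          + \<gamma> (int (fst p') - int i) * \<gamma> (int (snd p') - int k)
          + \<gamma> (int (fst p') - int k) * \<gamma> (int (snd p') - int i)"
          using expectation_pair_dev_mult[of i k "fst p'" "snd p'"] by (simp add: ik mult.commute)
        then show ?thesis by linarith
      qed
      ultimately show "w p * w p' * ?E \<le> ?K p' + ?A p' + ?B p'" by linarith
    qed
    also have "\<dots> = (\<Sum>p'\<in>P. ?K p') + (\<Sum>p'\<in>P. ?A p') + (\<Sum>p'\<in>P. ?B p')"
      by (simp add: sum.distrib)
    also have "\<dots> \<le> C + \<Gamma>\<^sup>2 + \<Gamma>\<^sup>2"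
    proof (intro add_mono sum_autocov_mult_le P)
      show "(\<Sum>p'\<in>P. ?K p') \<le> C"
        \<comment> \<open>With \<open>i\<close> fixed, distinct pairs give distinct lag pairs, so no
          cumulant is counted twice.\<close>
        using sum_cum4_le[OF P, of "\<lambda>p'. (int (fst p') - int i, int (snd p') - int i)" "int k - int i"]
        by (auto simp: inj_on_def prod_eq_iff)
    qed
    finally show "(\<Sum>p'\<in>P. w p * w p' * expectation (\<lambda>\<omega>. pair_dev p \<omega> * pair_dev p' \<omega>)) \<le> 2 * \<Gamma>\<^sup>2 + C" by simp
  qed
  finally show "expectation (\<lambda>\<omega>. (\<Sum>p\<in>P. w p * pair_dev p \<omega>)\<^sup>2) \<le> real (card P) * (2 * \<Gamma>\<^sup>2 + C)"
    by simp
qed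

end

section \<open>The Bartlett estimator\<close>

text \<open>The weight is placed on pairs of times instead of lags, and the maximum with 0 replaces
  the cut-off at lag \<open>q\<close>, so that sums can run over the whole square.\<close>

definition bartlett_kernel :: "nat \<Rightarrow> nat \<Rightarrow> nat \<Rightarrow> real" where
  "bartlett_kernel q i k = max 0 (1 - \<bar>real i - real k\<bar> / (real q + 1))"

lemma bartlett_kernel_commute: "bartlett_kernel q i k = bartlett_kernel q k i"
  by (simp add: bartlett_kernel_def abs_minus_commute)

lemma bartlett_kernel_nonneg: "0 \<le> bartlett_kernel q i k"
  by (simp add: bartlett_kernel_def)

lemma bartlett_kernel_le_1: "bartlett_kernel q i k \<le> 1"
  by (simp add: bartlett_kernel_def)

lemma bartlett_kernel_shift: "j \<le> q \<Longrightarrow> bartlett_kernel q i (i + j) = bartlett_weight q j"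
  by (simp add: bartlett_kernel_def bartlett_weight_def max_def field_simps)

text \<open>The weight already vanishes at lag \<open>q + 1\<close>, so the band has at most
  \<open>2 * q + 1\<close> entries per row; truncated subtraction only shortens it near 0.\<close>

lemma bartlett_kernel_eq_0:
  assumes "k \<notin> {i - q..i + q}"
  shows "bartlett_kernel q i k = 0"
proof -
  have "real q + 1 \<le> \<bar>real i - real k\<bar>" using assms by auto
  then have "1 \<le> \<bar>real i - real k\<bar> / (real q + 1)" by (simp add: field_simps)
  then show ?thesis by (simp add: bartlett_kernel_def)
qed

text \<open>The square splits into the diagonal and two triangles of equal sum; a pair above the
  diagonal is recoded by its lag and its first entry.\<close>

lemma sum_symmetric_by_lag:
  fixes f :: "nat \<Rightarrow> nat \<Rightarrow> real"
  assumes sym: "\<And>i k. f i k = f k i" and zero: "\<And>i j. j > q \<Longrightarrow> f i (i + j) = 0"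
  shows "(\<Sum>i=1..n. \<Sum>k=1..n. f i k)
       = (\<Sum>i=1..n. f i i) + 2 * (\<Sum>j=1..q. \<Sum>i\<in>{i. 1 \<le> i \<and> i + j \<le> n}. f i (i + j))"
proof -
  let ?I = "{1..n}"
  define D U L where "D = {p \<in> ?I \<times> ?I. fst p = snd p}" and "U = {p \<in> ?I \<times> ?I. fst p < snd p}"
    and "L = {p \<in> ?I \<times> ?I. snd p < fst p}"
  let ?f = "\<lambda>p. f (fst p) (snd p)"
  let ?g = "\<lambda>j. \<Sum>i\<in>{i. 1 \<le> i \<and> i + j \<le> n}. f i (i + j)"
  have fin: "finite D" "finite U" "finite L" unfolding D_def U_def L_def by auto
  have "(\<Sum>i=1..n. \<Sum>k=1..n. f i k) = sum ?f (?I \<times> ?I)"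
    by (simp add: sum.cartesian_product case_prod_beta)
  also have "?I \<times> ?I = D \<union> U \<union> L" unfolding D_def U_def L_def by auto
  also have "sum ?f \<dots> = sum ?f D + sum ?f U + sum ?f L"
    using fin by (subst sum.union_disjoint; (subst sum.union_disjoint)?) (auto simp: D_def U_def L_def)
  also have "sum ?f D = (\<Sum>i=1..n. f i i)"
    by (rule sum.reindex_bij_witness[of _ "\<lambda>i. (i, i)" fst]) (auto simp: D_def)
  also have "sum ?f L = sum ?f U"
    by (rule sum.reindex_bij_witness[of _ prod.swap prod.swap]) (auto simp: U_def L_def sym)
  also have "sum ?f U = (\<Sum>(j, i)\<in>(SIGMA j:{1..n}. {i. 1 \<le> i \<and> i + j \<le> n}). f i (i + j))"
    by (rule sum.reindex_bij_witness[of _ "\<lambda>(j, i). (i, i + j)" "\<lambda>(i, k). (k - i, i)"]) (auto simp: U_def)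
  also have "\<dots> = (\<Sum>j=1..n. ?g j)"
  proof (rule sum.Sigma[symmetric])
    show "\<forall>j\<in>{1..n}. finite {i. 1 \<le> i \<and> i + j \<le> n}"
      by (auto intro: finite_subset[of _ "{1..n}"])
  qed simp
  \<comment> \<open>\<open>q\<close> may exceed \<open>n\<close> or fall short of it. Lags above
    \<open>n\<close> have no pairs and lags above \<open>q\<close> have weight zero, so both ranges
    can be compared with \<open>max n q\<close>.\<close>
  also have "(\<Sum>j=1..n. ?g j) = (\<Sum>j=1..max n q. ?g j)"
  proof (rule sum.mono_neutral_left)
    show "\<forall>j\<in>{1..max n q} - {1..n}. ?g j = 0"
    proof
      fix j assume "j \<in> {1..max n q} - {1..n}"
      then have e: "{i. 1 \<le> i \<and> i + j \<le> n} = {}" by auto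
      show "?g j = 0" unfolding e by simp
    qed
  qed auto
  also have "(\<Sum>j=1..max n q. ?g j) = (\<Sum>j=1..q. ?g j)"
    by (rule sum.mono_neutral_right) (auto simp: zero)
  finally show ?thesis by simp
qed

lemma lrv_estimate_quadratic_form:
  fixes X :: "nat \<Rightarrow> real"
  defines "x \<equiv> (\<lambda>n i. X i - sample_mean X n)"
  shows "lrv_estimate X n q = (\<Sum>i=1..n. \<Sum>k=1..n. bartlett_kernel q i k * (x n i * x n k)) / real n"
proof -
  have "(\<Sum>i=1..n. \<Sum>k=1..n. bartlett_kernel q i k * (x n i * x n k))
      = (\<Sum>i=1..n. bartlett_kernel q i i * (x n i * x n i))
        + 2 * (\<Sum>j=1..q. \<Sum>i\<in>{i. 1 \<le> i \<and> i + j \<le> n}. bartlett_kernel q i (i + j) * (x n i * x n (i + j)))"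
    by (rule sum_symmetric_by_lag)
      (auto simp: bartlett_kernel_commute bartlett_kernel_eq_0 mult.commute mult.left_commute)
  \<comment> \<open>The diagonal is written with a shift by 0 so as to match
    \<open>sample_autocov\<close> at lag 0.\<close>
  also have "(\<Sum>i=1..n. bartlett_kernel q i i * (x n i * x n i)) = (\<Sum>i\<in>{i. 1 \<le> i \<and> i + 0 \<le> n}. x n i * x n (i + 0))"
    by (intro sum.cong) (auto simp: bartlett_kernel_def)
  also have "(\<Sum>j=1..q. \<Sum>i\<in>{i. 1 \<le> i \<and> i + j \<le> n}. bartlett_kernel q i (i + j) * (x n i * x n (i + j)))
      = (\<Sum>j=1..q. bartlett_weight q j * (\<Sum>i\<in>{i. 1 \<le> i \<and> i + j \<le> n}. x n i * x n (i + j)))"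
    by (intro sum.cong refl) (auto simp: bartlett_kernel_shift sum_distrib_left intro!: sum.cong)
  finally have "(\<Sum>i=1..n. \<Sum>k=1..n. bartlett_kernel q i k * (x n i * x n k)) / real n
      = (1 / real n) * (\<Sum>i\<in>{i. 1 \<le> i \<and> i + 0 \<le> n}. x n i * x n (i + 0))
        + (1 / real n) * (2 * (\<Sum>j=1..q. bartlett_weight q j * (\<Sum>i\<in>{i. 1 \<le> i \<and> i + j \<le> n}. x n i * x n (i + j))))"
    by (simp add: add_divide_distrib)
  also have "(1 / real n) * (2 * (\<Sum>j=1..q. bartlett_weight q j * (\<Sum>i\<in>{i. 1 \<le> i \<and> i + j \<le> n}. x n i * x n (i + j))))
      = 2 * (\<Sum>j=1..q. bartlett_weight q j * ((1 / real n) * (\<Sum>i\<in>{i. 1 \<le> i \<and> i + j \<le> n}. x n i * x n (i + j))))"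
    unfolding mult.left_commute[of "1 / real n"] sum_distrib_left[of "1 / real n"] ..
  finally show ?thesis
    unfolding lrv_estimate_def sample_autocov_def x_def by (rule sym)
qed

text \<open>Symmetry merges the two cross terms into one linear form whose coefficients are the row
  sums of \<open>b\<close>.\<close>

lemma centred_quadratic_form:
  fixes b :: "nat \<Rightarrow> nat \<Rightarrow> real"
  assumes "\<And>i k. b i k = b k i"
  shows "(\<Sum>i\<in>I. \<Sum>k\<in>I. b i k * ((u i - m) * (u k - m)))
       = (\<Sum>i\<in>I. \<Sum>k\<in>I. b i k * (u i * u k)) - 2 * m * (\<Sum>i\<in>I. (\<Sum>k\<in>I. b i k) * u i)
         + m\<^sup>2 * (\<Sum>i\<in>I. \<Sum>k\<in>I. b i k)"
proof -
  have "(\<Sum>i\<in>I. \<Sum>k\<in>I. b i k * u k) = (\<Sum>i\<in>I. \<Sum>k\<in>I. b i k * u i)"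
    by (subst sum.swap) (simp add: assms)
  then have 1: "(\<Sum>i\<in>I. \<Sum>k\<in>I. m * (b i k * u i)) + (\<Sum>i\<in>I. \<Sum>k\<in>I. m * (b i k * u k))
      = 2 * m * (\<Sum>i\<in>I. (\<Sum>k\<in>I. b i k) * u i)"
    by (simp add: sum_distrib_left[symmetric] sum_distrib_right)
  have "(\<Sum>i\<in>I. \<Sum>k\<in>I. b i k * ((u i - m) * (u k - m)))
      = (\<Sum>i\<in>I. \<Sum>k\<in>I. b i k * (u i * u k) - m * (b i k * u i) - m * (b i k * u k) + m\<^sup>2 * b i k)"
    by (intro sum.cong refl) (simp add: algebra_simps power2_eq_square)
  also have "\<dots> = (\<Sum>i\<in>I. \<Sum>k\<in>I. b i k * (u i * u k)) - (\<Sum>i\<in>I. \<Sum>k\<in>I. m * (b i k * u i))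
      - (\<Sum>i\<in>I. \<Sum>k\<in>I. m * (b i k * u k)) + (\<Sum>i\<in>I. \<Sum>k\<in>I. m\<^sup>2 * b i k)"
    by (simp add: sum.distrib sum_subtractf)
  finally show ?thesis using 1 by (simp add: sum_distrib_left[symmetric])
qed

lemma sum_bartlett_kernel_le: "(\<Sum>k=1..n. bartlett_kernel q i k) \<le> 2 * real q + 1"
proof -
  have "(\<Sum>k=1..n. bartlett_kernel q i k) = (\<Sum>k\<in>{1..n} \<inter> {i - q..i + q}. bartlett_kernel q i k)"
    by (rule sum.mono_neutral_right) (auto simp: bartlett_kernel_eq_0)
  also have "\<dots> \<le> (\<Sum>k\<in>{i - q..i + q}. 1)"
    by (intro order.trans[OF sum_mono2 sum_mono]) (auto simp: bartlett_kernel_nonneg bartlett_kernel_le_1)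
  also have "\<dots> \<le> 2 * real q + 1" by auto
  finally show ?thesis .
qed

lemma (in prob_space) expectation_abs_le_sqrt:
  fixes U :: "'a \<Rightarrow> real"
  assumes [measurable]: "U \<in> borel_measurable M" and U2: "integrable M (\<lambda>\<omega>. (U \<omega>)\<^sup>2)"
  shows "integrable M U" and "expectation (\<lambda>\<omega>. \<bar>U \<omega>\<bar>) \<le> sqrt (expectation (\<lambda>\<omega>. (U \<omega>)\<^sup>2))"
proof -
  have abs_le: "\<bar>u\<bar> \<le> 1 + u\<^sup>2" for u :: real
    using sum_squares_bound[of 1 "\<bar>u\<bar>"] by simp
  show int: "integrable M U"
  proof (rule Bochner_Integration.integrable_bound)
    show "integrable M (\<lambda>\<omega>. 1 + (U \<omega>)\<^sup>2)" using U2 by simp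
    show "AE \<omega> in M. norm (U \<omega>) \<le> norm (1 + (U \<omega>)\<^sup>2)"
      unfolding real_norm_def by (intro AE_I2 order.trans[OF abs_le abs_ge_self])
  qed simp
  \<comment> \<open>Jensen's inequality for the square, read off from the nonnegative variance of
    the absolute value.\<close>
  have "0 \<le> variance (\<lambda>\<omega>. \<bar>U \<omega>\<bar>)" by (rule variance_positive)
  also have "\<dots> = expectation (\<lambda>\<omega>. \<bar>U \<omega>\<bar>\<^sup>2) - (expectation (\<lambda>\<omega>. \<bar>U \<omega>\<bar>))\<^sup>2"
    using int U2 by (intro variance_eq) auto
  finally show "expectation (\<lambda>\<omega>. \<bar>U \<omega>\<bar>) \<le> sqrt (expectation (\<lambda>\<omega>. (U \<omega>)\<^sup>2))"
    by (intro real_le_rsqrt) simp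
qed

section \<open>Moment bounds for partial sums and for the Bartlett form\<close>

context summable_cumulants
begin

definition S :: "nat \<Rightarrow> 'a \<Rightarrow> real" where "S n \<omega> = (\<Sum>i=1..n. y i \<omega>)"

lemma measurable_S [measurable]: "S n \<in> borel_measurable M"
  unfolding S_def[abs_def] by measurable

lemma S_second_moment:
  "integrable M (\<lambda>\<omega>. (S n \<omega>)\<^sup>2)" "expectation (\<lambda>\<omega>. (S n \<omega>)\<^sup>2) \<le> real n * \<Gamma>"
  using linear_form_second_moment[of "{1..n}" "\<lambda>_. 1" 1] by (simp_all add: S_def)

lemma S_second_moment_eq:
  "expectation (\<lambda>\<omega>. (S n \<omega>)\<^sup>2) = (\<Sum>i=1..n. \<Sum>k=1..n. \<gamma> (int k - int i))"
  unfolding S_def power2_eq_square sum_product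
  by (simp add: Bochner_Integration.integral_sum Bochner_Integration.integrable_sum integrable_prod2 expectation_prod2)

lemma S_fourth_moment:
  "integrable M (\<lambda>\<omega>. (S n \<omega>) ^ 4)"
  "expectation (\<lambda>\<omega>. (S n \<omega>) ^ 4) \<le> (6 * \<Gamma>\<^sup>2 + 2 * C) * (real n)\<^sup>2"
proof -
  let ?P = "{1..n} \<times> {1..n}"
  define m where "m = expectation (\<lambda>\<omega>. (S n \<omega>)\<^sup>2)"
  define D where "D \<omega> = (\<Sum>p\<in>?P. 1 * pair_dev p \<omega>)" for \<omega>
  have D2: "integrable M (\<lambda>\<omega>. (D \<omega>)\<^sup>2)"
    "expectation (\<lambda>\<omega>. (D \<omega>)\<^sup>2) \<le> real (card ?P) * (2 * \<Gamma>\<^sup>2 + C)"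
    unfolding D_def by (rule quadratic_form_variance; simp)+
  have SD: "(S n \<omega>)\<^sup>2 = D \<omega> + m" for \<omega>
  proof -
    have "D \<omega> = (\<Sum>i=1..n. \<Sum>k=1..n. y i \<omega> * y k \<omega> - \<gamma> (int k - int i))"
      by (simp add: D_def pair_dev_def sum.cartesian_product case_prod_beta)
    also have "\<dots> = (S n \<omega>)\<^sup>2 - m"
      unfolding m_def S_second_moment_eq by (simp add: sum_subtractf S_def power2_eq_square sum_product)
    finally show ?thesis by simp
  qed
  have bound: "(S n \<omega>) ^ 4 \<le> 2 * (D \<omega>)\<^sup>2 + 2 * m\<^sup>2" for \<omega>
  proof -
    have "(S n \<omega>) ^ 4 = ((S n \<omega>)\<^sup>2)\<^sup>2" by (simp flip: power_mult)
    also have "\<dots> = (D \<omega> + m)\<^sup>2" by (simp add: SD)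
    also have "\<dots> \<le> 2 * (D \<omega>)\<^sup>2 + 2 * m\<^sup>2"
      using sum_squares_bound[of "D \<omega>" m] by (simp add: power2_sum)
    finally show ?thesis .
  qed
  have int: "integrable M (\<lambda>\<omega>. 2 * (D \<omega>)\<^sup>2 + 2 * m\<^sup>2)" using D2 by simp
  show i4: "integrable M (\<lambda>\<omega>. (S n \<omega>) ^ 4)"
    by (rule Bochner_Integration.integrable_bound[OF int]) (use bound in auto)
  have m: "0 \<le> m" "m \<le> real n * \<Gamma>" unfolding m_def using S_second_moment by simp_all
  have "expectation (\<lambda>\<omega>. (S n \<omega>) ^ 4) \<le> expectation (\<lambda>\<omega>. 2 * (D \<omega>)\<^sup>2 + 2 * m\<^sup>2)"
    using i4 int bound by (intro integral_mono) auto
  also have "\<dots> = 2 * expectation (\<lambda>\<omega>. (D \<omega>)\<^sup>2) + 2 * m\<^sup>2"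
    using D2 by (simp add: prob_space)
  also have "\<dots> \<le> 2 * (real (card ?P) * (2 * \<Gamma>\<^sup>2 + C)) + 2 * (real n * \<Gamma>)\<^sup>2"
    using D2(2) m by (intro add_mono mult_left_mono power_mono) auto
  \<comment> \<open>There are \<open>n^2\<close> pairs, so the fluctuation contributes
    \<open>2 * (2 * \<Gamma>^2 + C)\<close> and the squared mean
    \<open>2 * \<Gamma>^2\<close>.\<close>
  also have "\<dots> = (6 * \<Gamma>\<^sup>2 + 2 * C) * (real n)\<^sup>2"
    by (simp add: power2_eq_square algebra_simps)
  finally show "expectation (\<lambda>\<omega>. (S n \<omega>) ^ 4) \<le> (6 * \<Gamma>\<^sup>2 + 2 * C) * (real n)\<^sup>2" .
qed

text \<open>This is the expectation of the form in the uncentred variables; the effect of the sample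
  mean is treated separately.\<close>

definition bartlett_mean :: "nat \<Rightarrow> nat \<Rightarrow> real" where
  "bartlett_mean n q = (\<Sum>i=1..n. \<Sum>k=1..n. bartlett_kernel q i k * \<gamma> (int k - int i)) / real n"

lemma bartlett_form_variance:
  fixes n q :: nat
  assumes n: "n > 0"
  defines "V \<equiv> \<lambda>\<omega>. (\<Sum>i=1..n. \<Sum>k=1..n. bartlett_kernel q i k * (y i \<omega> * y k \<omega>)) / real n - bartlett_mean n q"
  shows "integrable M (\<lambda>\<omega>. (V \<omega>)\<^sup>2)"
    and "expectation (\<lambda>\<omega>. (V \<omega>)\<^sup>2) \<le> (2 * real q + 1) / real n * (2 * \<Gamma>\<^sup>2 + C)"
proof -
  \<comment> \<open>Restricting to the band before applying the variance bound is what yields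
    \<open>n * (2 * q + 1)\<close> pairs in place of \<open>n^2\<close>.\<close>
  define P where "P = (SIGMA i:{1..n}. {1..n} \<inter> {i - q..i + q})"
  let ?w = "\<lambda>p. bartlett_kernel q (fst p) (snd p)"
  define Q where "Q \<omega> = (\<Sum>p\<in>P. ?w p * pair_dev p \<omega>)" for \<omega>
  have finP: "finite P" unfolding P_def by auto
  have "card P = (\<Sum>i\<in>{1..n}. card ({1..n} \<inter> {i - q..i + q}))"
    unfolding P_def by (subst card_SigmaI) auto
  also have "\<dots> \<le> (\<Sum>i\<in>{1..n}. 2 * q + 1)"
  proof (rule sum_mono)
    fix i
    have "card ({1..n} \<inter> {i - q..i + q}) \<le> card {i - q..i + q}" by (intro card_mono) auto
    also have "\<dots> \<le> 2 * q + 1" by simp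
    finally show "card ({1..n} \<inter> {i - q..i + q}) \<le> 2 * q + 1" .
  qed
  also have "\<dots> = n * (2 * q + 1)" by simp
  finally have cardP: "real (card P) \<le> real n * (2 * real q + 1)"
    by (metis (no_types, opaque_lifting) of_nat_1 of_nat_add of_nat_mono of_nat_mult of_nat_numeral)
  have Q2: "integrable M (\<lambda>\<omega>. (Q \<omega>)\<^sup>2)" "expectation (\<lambda>\<omega>. (Q \<omega>)\<^sup>2) \<le> real (card P) * (2 * \<Gamma>\<^sup>2 + C)"
    unfolding Q_def using finP
    by (auto intro!: quadratic_form_variance simp: abs_le_iff bartlett_kernel_le_1
        order.trans[OF _ bartlett_kernel_nonneg, of "-1"] minus_le_iff)
  have V: "V \<omega> = Q \<omega> / real n" for \<omega>
  proof -
    have "(\<Sum>i=1..n. \<Sum>k=1..n. bartlett_kernel q i k * (y i \<omega> * y k \<omega>))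
        - (\<Sum>i=1..n. \<Sum>k=1..n. bartlett_kernel q i k * \<gamma> (int k - int i))
      = (\<Sum>p\<in>{1..n} \<times> {1..n}. ?w p * pair_dev p \<omega>)"
      by (simp add: sum_subtractf[symmetric] pair_dev_def sum.cartesian_product case_prod_beta right_diff_distrib)
    also have "\<dots> = Q \<omega>"
      unfolding Q_def
    proof (rule sum.mono_neutral_right)
      show "\<forall>p\<in>{1..n} \<times> {1..n} - P. ?w p * pair_dev p \<omega> = 0"
      proof
        fix p assume "p \<in> {1..n} \<times> {1..n} - P"
        then have "snd p \<notin> {fst p - q..fst p + q}" unfolding P_def by force
        then show "?w p * pair_dev p \<omega> = 0" by (subst bartlett_kernel_eq_0) simp_all
      qed
    qed (auto simp: P_def)
    finally show ?thesis by (simp add: V_def bartlett_mean_def diff_divide_distrib[symmetric])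
  qed
  show "integrable M (\<lambda>\<omega>. (V \<omega>)\<^sup>2)" unfolding V using Q2 by (simp add: power_divide)
  have "expectation (\<lambda>\<omega>. (V \<omega>)\<^sup>2) = expectation (\<lambda>\<omega>. (Q \<omega>)\<^sup>2) / (real n)\<^sup>2"
    unfolding V by (simp add: power_divide)
  also have "\<dots> \<le> real n * (2 * real q + 1) * (2 * \<Gamma>\<^sup>2 + C) / (real n)\<^sup>2"
    using Q2(2) cardP C_nonneg
    by (intro divide_right_mono order.trans[OF Q2(2)] mult_right_mono) auto
  also have "\<dots> = (2 * real q + 1) / real n * (2 * \<Gamma>\<^sup>2 + C)"
    using n by (simp add: power2_eq_square)
  finally show "expectation (\<lambda>\<omega>. (V \<omega>)\<^sup>2) \<le> (2 * real q + 1) / real n * (2 * \<Gamma>\<^sup>2 + C)" .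
qed

text \<open>Second moments suffice here: the error consists of a product of the two linear forms
  \<open>S n\<close> and \<open>L\<close>, and of a multiple of the square of
  \<open>S n\<close>.\<close>

lemma bartlett_centring_error:
  fixes n q :: nat
  assumes n: "n > 0"
  defines "R \<equiv> \<lambda>\<omega>. (\<Sum>i=1..n. \<Sum>k=1..n. bartlett_kernel q i k * ((y i \<omega> - S n \<omega> / real n) * (y k \<omega> - S n \<omega> / real n))) / real n
      - (\<Sum>i=1..n. \<Sum>k=1..n. bartlett_kernel q i k * (y i \<omega> * y k \<omega>)) / real n"
  shows "integrable M R" and "expectation (\<lambda>\<omega>. \<bar>R \<omega>\<bar>) \<le> 3 * (2 * real q + 1) / real n * \<Gamma>"
proof -
  define b where "b = 2 * real q + 1"
  have b: "b > 0" by (simp add: b_def)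
  define a where "a i = (\<Sum>k=1..n. bartlett_kernel q i k)" for i
  define L where "L \<omega> = (\<Sum>i=1..n. a i * y i \<omega>)" for \<omega>
  have a0: "0 \<le> a i" for i unfolding a_def by (intro sum_nonneg bartlett_kernel_nonneg)
  have a1: "a i \<le> b" for i unfolding a_def b_def by (rule sum_bartlett_kernel_le)
  have L2: "integrable M (\<lambda>\<omega>. (L \<omega>)\<^sup>2)" "expectation (\<lambda>\<omega>. (L \<omega>)\<^sup>2) \<le> b\<^sup>2 * real n * \<Gamma>"
    unfolding L_def using linear_form_second_moment[of "{1..n}" a b] a0 a1 by auto
  have R: "R \<omega> = (- 2 * (S n \<omega> / real n) * L \<omega> + (S n \<omega> / real n)\<^sup>2 * (\<Sum>i=1..n. a i)) / real n" for \<omega>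
    unfolding R_def L_def a_def diff_divide_distrib[symmetric]
    by (subst centred_quadratic_form[OF bartlett_kernel_commute]) simp
  have [measurable]: "L \<in> borel_measurable M" unfolding L_def[abs_def] by measurable
  \<comment> \<open>The cross term is split by the inequality
    \<open>2 * s * l \<le> b * s^2 + l^2 / b\<close>. The weight \<open>b\<close> balances the two
    parts, since the coefficients of \<open>L\<close> are up to \<open>b\<close> times those of
    \<open>S n\<close>. Together with the quadratic term three contributions of at most
    \<open>b * n * \<Gamma>\<close> arise, the origin of the factor 3.\<close>
  let ?B = "\<lambda>\<omega>. (2 * b * (S n \<omega>)\<^sup>2 + (L \<omega>)\<^sup>2 / b) / (real n)\<^sup>2"
  have bound: "\<bar>R \<omega>\<bar> \<le> ?B \<omega>" for \<omega>
  proof -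
    have "2 * \<bar>S n \<omega>\<bar> * \<bar>L \<omega>\<bar> \<le> b * (S n \<omega>)\<^sup>2 + (L \<omega>)\<^sup>2 / b"
    proof -
      have "2 * (b * \<bar>S n \<omega>\<bar>) * \<bar>L \<omega>\<bar> \<le> (b * \<bar>S n \<omega>\<bar>)\<^sup>2 + \<bar>L \<omega>\<bar>\<^sup>2" by (rule sum_squares_bound)
      then have "b * (2 * \<bar>S n \<omega>\<bar> * \<bar>L \<omega>\<bar>) \<le> b * (b * (S n \<omega>)\<^sup>2 + (L \<omega>)\<^sup>2 / b)"
        using b by (simp add: power_mult_distrib algebra_simps power2_eq_square)
      then show ?thesis using b by (simp only: mult_le_cancel_left_pos)
    qed
    moreover have "(S n \<omega>)\<^sup>2 * ((\<Sum>i=1..n. a i) / real n) \<le> (S n \<omega>)\<^sup>2 * b"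
    proof (rule mult_left_mono)
      have "(\<Sum>i=1..n. a i) \<le> (\<Sum>i=1..n. b)" by (intro sum_mono a1)
      then show "(\<Sum>i=1..n. a i) / real n \<le> b" using n by (simp add: field_simps)
    qed simp
    moreover have "\<bar>R \<omega>\<bar> \<le> (2 * \<bar>S n \<omega>\<bar> * \<bar>L \<omega>\<bar> + (S n \<omega>)\<^sup>2 * ((\<Sum>i=1..n. a i) / real n)) / (real n)\<^sup>2"
    proof -
      have "\<bar>R \<omega>\<bar> \<le> (\<bar>2 * (S n \<omega> / real n) * L \<omega>\<bar> + \<bar>(S n \<omega> / real n)\<^sup>2 * (\<Sum>i=1..n. a i)\<bar>) / real n"
      proof -
        have tri: "\<bar>- 2 * s * l + t\<bar> \<le> \<bar>2 * s * l\<bar> + \<bar>t\<bar>" for s l t :: real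
          using abs_triangle_ineq[of "- 2 * s * l" t] by simp
        show ?thesis
          unfolding R abs_divide abs_of_nat by (rule divide_right_mono[OF tri]) simp
      qed
      also have "\<dots> = (2 * \<bar>S n \<omega>\<bar> * \<bar>L \<omega>\<bar> + (S n \<omega>)\<^sup>2 * ((\<Sum>i=1..n. a i) / real n)) / (real n)\<^sup>2"
        using n sum_nonneg[of "{1..n}" a] a0
        by (simp add: abs_mult power2_eq_square add_divide_distrib)
      finally show ?thesis .
    qed
    ultimately show ?thesis
      by (elim order.trans) (intro divide_right_mono, auto simp: algebra_simps)
  qed
  have intB: "integrable M ?B" using L2 S_second_moment by simp
  have [measurable]: "R \<in> borel_measurable M" unfolding R[abs_def] by measurable
  show iR: "integrable M R"
    by (rule Bochner_Integration.integrable_bound[OF intB]) (use bound order.trans[OF bound abs_ge_self] in auto)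
  have "expectation (\<lambda>\<omega>. \<bar>R \<omega>\<bar>) \<le> expectation ?B"
    using iR intB bound by (intro integral_mono) auto
  also have "\<dots> = (2 * b * expectation (\<lambda>\<omega>. (S n \<omega>)\<^sup>2) + expectation (\<lambda>\<omega>. (L \<omega>)\<^sup>2) / b) / (real n)\<^sup>2"
    using L2 S_second_moment by simp
  also have "\<dots> \<le> (2 * b * (real n * \<Gamma>) + (b\<^sup>2 * real n * \<Gamma>) / b) / (real n)\<^sup>2"
    using b L2 S_second_moment by (intro divide_right_mono add_mono mult_left_mono) auto
  also have "\<dots> = 3 * b / real n * \<Gamma>"
    using b n by (simp add: power2_eq_square field_simps)
  finally show "expectation (\<lambda>\<omega>. \<bar>R \<omega>\<bar>) \<le> 3 * (2 * real q + 1) / real n * \<Gamma>" by (simp add: b_def)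
qed

text \<open>\<open>E S_n^2\<close> is the same double sum with all weights equal to 1, so the
  difference is governed by the weight lost at each lag. Finitely many lags carry almost all of
  \<open>\<Gamma>\<close>, and at each of these the loss vanishes as \<open>q\<close> grows.\<close>

lemma bartlett_bias_tendsto:
  assumes q: "filterlim q at_top sequentially"
  shows "(\<lambda>n. bartlett_mean n (q n) - expectation (\<lambda>\<omega>. (S n \<omega>)\<^sup>2) / real n) \<longlonglongrightarrow> 0"
proof (rule tendstoI)
  fix e :: real assume e: "e > 0"
  \<comment> \<open>The weight lost at lag \<open>d\<close>: its bound proportional to
    \<open>\<bar>d\<bar>\<close> serves on the finite set \<open>F\<close>, its bound 1 off
    it.\<close>
  define u where "u m d = min 1 (\<bar>real_of_int d\<bar> / (real m + 1))" for m :: nat and d :: int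
  have u: "0 \<le> u m d" "u m d \<le> 1" "u m d \<le> \<bar>real_of_int d\<bar> / (real m + 1)" for m d
    by (auto simp: u_def)
  have ku: "1 - bartlett_kernel m i k = u m (int k - int i)" for m i k
    by (simp add: bartlett_kernel_def u_def abs_minus_commute max_def min_def)
  obtain F where F: "finite F" "dist (\<Sum>d\<in>F. \<bar>\<gamma> d\<bar>) \<Gamma> \<le> e / 4"
    using infsum_finite_approximation[OF autocov_summable, of "e / 4"] e unfolding \<Gamma>_def by auto
  define c where "c = (\<Sum>d\<in>F. \<bar>real_of_int d\<bar> * \<bar>\<gamma> d\<bar>)"
  have "(\<lambda>m. c * inverse (real (Suc m))) \<longlonglongrightarrow> 0"
    by (intro tendsto_mult_right_zero LIMSEQ_inverse_real_of_nat)
  from filterlim_compose[OF this q] have "(\<lambda>n. c / (real (q n) + 1)) \<longlonglongrightarrow> 0"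
    by (simp add: divide_inverse add.commute)
  then have "\<forall>\<^sub>F n in sequentially. c / (real (q n) + 1) < e / 4"
    using e by (intro order_tendstoD(2)) auto
  then show "\<forall>\<^sub>F n in sequentially. dist (bartlett_mean n (q n) - expectation (\<lambda>\<omega>. (S n \<omega>)\<^sup>2) / real n) 0 < e"
  proof (rule eventually_mono)
    fix n assume small: "c / (real (q n) + 1) < e / 4"
    have tail: "(\<Sum>d\<in>A. u (q n) d * \<bar>\<gamma> d\<bar>) \<le> e / 2" if A: "finite A" for A
    proof -
      have "(\<Sum>d\<in>A. u (q n) d * \<bar>\<gamma> d\<bar>) = (\<Sum>d\<in>A \<inter> F. u (q n) d * \<bar>\<gamma> d\<bar>) + (\<Sum>d\<in>A - F. u (q n) d * \<bar>\<gamma> d\<bar>)"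
        using A by (metis sum.Int_Diff)
      also have "(\<Sum>d\<in>A \<inter> F. u (q n) d * \<bar>\<gamma> d\<bar>) \<le> (\<Sum>d\<in>F. u (q n) d * \<bar>\<gamma> d\<bar>)"
        using F u by (intro sum_mono2) auto
      also have "\<dots> \<le> (\<Sum>d\<in>F. \<bar>real_of_int d\<bar> / (real (q n) + 1) * \<bar>\<gamma> d\<bar>)"
        using u by (intro sum_mono mult_right_mono) auto
      also have "\<dots> = c / (real (q n) + 1)"
        by (simp add: c_def sum_divide_distrib)
      also have "(\<Sum>d\<in>A - F. u (q n) d * \<bar>\<gamma> d\<bar>) \<le> (\<Sum>d\<in>A - F. 1 * \<bar>\<gamma> d\<bar>)"
        using u by (intro sum_mono mult_right_mono) auto
      also have "\<dots> \<le> e / 4"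
      proof -
        have "(\<Sum>d\<in>F. \<bar>\<gamma> d\<bar>) + (\<Sum>d\<in>A - F. \<bar>\<gamma> d\<bar>) = (\<Sum>d\<in>F \<union> (A - F). \<bar>\<gamma> d\<bar>)"
          using A F by (subst sum.union_disjoint) auto
        also have "\<dots> \<le> \<Gamma>" using sum_autocov_le[of "F \<union> (A - F)" "\<lambda>d. d"] A F by simp
        finally show ?thesis using F(2) unfolding dist_real_def mult_1 by linarith
      qed
      finally show ?thesis using small by linarith
    qed
    have "\<bar>bartlett_mean n (q n) - expectation (\<lambda>\<omega>. (S n \<omega>)\<^sup>2) / real n\<bar>
        = \<bar>\<Sum>i=1..n. \<Sum>k=1..n. - (u (q n) (int k - int i) * \<gamma> (int k - int i))\<bar> / real n"
      unfolding bartlett_mean_def S_second_moment_eq ku[symmetric]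
      by (simp add: diff_divide_distrib[symmetric] sum_subtractf[symmetric] algebra_simps)
    also have "\<dots> \<le> (\<Sum>i=1..n. \<Sum>k=1..n. u (q n) (int k - int i) * \<bar>\<gamma> (int k - int i)\<bar>) / real n"
      using u by (intro divide_right_mono order.trans[OF sum_abs] sum_mono order.trans[OF sum_abs])
        (auto simp: abs_mult)
    also have "\<dots> \<le> (\<Sum>i=1..n. e / 2) / real n"
    proof (intro divide_right_mono sum_mono)
      fix i
      have "(\<Sum>k=1..n. u (q n) (int k - int i) * \<bar>\<gamma> (int k - int i)\<bar>)
          = (\<Sum>d\<in>(\<lambda>k. int k - int i) ` {1..n}. u (q n) d * \<bar>\<gamma> d\<bar>)"
        by (subst sum.reindex) (auto simp: inj_on_def)
      then show "(\<Sum>k=1..n. u (q n) (int k - int i) * \<bar>\<gamma> (int k - int i)\<bar>) \<le> e / 2"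
        using tail by simp
    qed simp
    also have "\<dots> < e" using e by (cases "n = 0") auto
    finally show "dist (bartlett_mean n (q n) - expectation (\<lambda>\<omega>. (S n \<omega>)\<^sup>2) / real n) 0 < e"
      by simp
  qed
qed

end

section \<open>The partial sum process and the CUSUM statistic\<close>

lemma floor_step_cadlag01:
  fixes F :: "int \<Rightarrow> real"
  shows "(\<lambda>t. F \<lfloor>real n * t\<rfloor>) \<in> cadlag01"
proof (cases "n = 0")
  case False
  then have n: "real n > 0" by simp
  have "((\<lambda>t. F \<lfloor>real n * t\<rfloor>) \<longlongrightarrow> F \<lfloor>real n * t\<rfloor>) (at_right t)" for t
  proof (rule tendsto_eventually, rule eventually_at_rightI)
    show "t < (of_int \<lfloor>real n * t\<rfloor> + 1) / real n"
      using n by (simp add: pos_less_divide_eq mult.commute)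
    fix s assume s: "s \<in> {t<..<(of_int \<lfloor>real n * t\<rfloor> + 1) / real n}"
    have "real n * t \<le> real n * s" using s n by simp
    moreover have "real n * s < of_int \<lfloor>real n * t\<rfloor> + 1"
      using s n by (simp add: pos_less_divide_eq mult.commute)
    ultimately have "\<lfloor>real n * s\<rfloor> = \<lfloor>real n * t\<rfloor>" by linarith
    then show "F \<lfloor>real n * s\<rfloor> = F \<lfloor>real n * t\<rfloor>" by simp
  qed
  \<comment> \<open>Just to the left of \<open>t\<close> the floor equals the ceiling at
    \<open>t\<close> minus one, whether or not \<open>real n * t\<close> is an integer.\<close>
  moreover have "((\<lambda>t. F \<lfloor>real n * t\<rfloor>) \<longlongrightarrow> F (\<lceil>real n * t\<rceil> - 1)) (at_left t)" for t
  proof (rule tendsto_eventually, rule eventually_at_leftI)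
    have "of_int \<lceil>real n * t\<rceil> - 1 < real n * t" by linarith
    then show "(of_int \<lceil>real n * t\<rceil> - 1) / real n < t"
      using n by (simp add: pos_divide_less_eq mult.commute)
    fix s assume s: "s \<in> {(of_int \<lceil>real n * t\<rceil> - 1) / real n<..<t}"
    have "real n * s < real n * t" using s n by simp
    moreover have "of_int \<lceil>real n * t\<rceil> - 1 < real n * s"
      using s n by (simp add: pos_divide_less_eq mult.commute)
    ultimately have "\<lfloor>real n * s\<rfloor> = \<lceil>real n * t\<rceil> - 1" by linarith
    then show "F \<lfloor>real n * s\<rfloor> = F (\<lceil>real n * t\<rceil> - 1)" by simp
  qed
  ultimately show ?thesis unfolding cadlag01_def by blast
qed (auto simp: cadlag01_def)

lemma bridge_sup_scale:
  assumes x: "x \<in> cadlag01" and cx: "(\<lambda>t. c * x t) \<in> cadlag01" and c: "c > 0"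
  shows "bridge_sup (\<lambda>t. c * x t) = c * bridge_sup x"
proof (rule antisym)
  have eq: "\<bar>c * x t - t * (c * x 1)\<bar> = c * \<bar>x t - t * x 1\<bar>" for t
  proof -
    have "c * x t - t * (c * x 1) = c * (x t - t * x 1)" by (simp add: algebra_simps)
    then show ?thesis using c by (simp add: abs_mult)
  qed
  show "bridge_sup (\<lambda>t. c * x t) \<le> c * bridge_sup x"
    using bridge_sup_upper[OF x] c by (intro bridge_sup_least) (simp add: eq)
  have "bridge_sup x \<le> bridge_sup (\<lambda>t. c * x t) / c"
  proof (rule bridge_sup_least)
    fix t :: real assume "t \<in> {0..1}"
    from bridge_sup_upper[OF cx this] show "\<bar>x t - t * x 1\<bar> \<le> bridge_sup (\<lambda>t. c * x t) / c"
      using c by (simp add: eq pos_le_divide_eq mult.commute)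
  qed
  then show "c * bridge_sup x \<le> bridge_sup (\<lambda>t. c * x t)"
    using c by (simp add: pos_le_divide_eq mult.commute)
qed

text \<open>\<open>wiener01\<close> gives the law of increments only, so the endpoint is read as the
  increment from time 0.\<close>

lemma wiener01_endpoint_moments:
  assumes W: "wiener01 N W"
  shows "integrable N (\<lambda>\<omega>. (W 1 \<omega>) ^ 4)" and "integral\<^sup>L N (\<lambda>\<omega>. (W 1 \<omega>)\<^sup>2) = 1"
proof -
  interpret prob_space N using W by (simp add: wiener01_def)
  have "distributed N lborel (\<lambda>\<omega>. W 1 \<omega> - W 0 \<omega>) (normal_density 0 (sqrt (1 - 0)))"
  proof -
    have "0 \<le> (0::real) \<and> (0::real) < 1 \<and> (1::real) \<le> 1" by simp
    then show ?thesis using W unfolding wiener01_def by blast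
  qed
  then have D: "distributed N lborel (\<lambda>\<omega>. W 1 \<omega> - W 0 \<omega>) (normal_density 0 1)" by simp
  have W0: "W 1 \<omega> - W 0 \<omega> = W 1 \<omega>" if "\<omega> \<in> space N" for \<omega>
    using W that by (simp add: wiener01_def)
  have "integrable lborel (\<lambda>x. normal_density 0 1 x * x ^ 4)"
    using integrable.intros[OF normal_moment_even[of 1 0 2]] by simp
  then have "integrable N (\<lambda>\<omega>. (W 1 \<omega> - W 0 \<omega>) ^ 4)"
    by (subst distributed_integrable[OF D, symmetric]) auto
  then show "integrable N (\<lambda>\<omega>. (W 1 \<omega>) ^ 4)"
    by (subst Bochner_Integration.integrable_cong[OF refl, of _ _ "\<lambda>\<omega>. (W 1 \<omega> - W 0 \<omega>) ^ 4"]) (simp_all add: W0)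
  have "integral\<^sup>L N (\<lambda>\<omega>. (W 1 \<omega>)\<^sup>2) = integral\<^sup>L N (\<lambda>\<omega>. (W 1 \<omega> - W 0 \<omega>)\<^sup>2)"
    by (rule Bochner_Integration.integral_cong) (simp_all add: W0)
  also have "\<dots> = (\<integral>x. normal_density 0 1 x * x\<^sup>2 \<partial>lborel)"
    by (subst distributed_integral[OF D, symmetric]) auto
  also have "\<dots> = 1"
    using integral_normal_moment_even[of 1 0 1] by simp
  finally show "integral\<^sup>L N (\<lambda>\<omega>. (W 1 \<omega>)\<^sup>2) = 1" .
qed

context summable_cumulants
begin

text \<open>Kept in the integer-indexed form of hypothesis (a), so that the hypothesis can be stated
  through this constant by unfolding.\<close>

definition partial_sum_process :: "nat \<Rightarrow> 'a \<Rightarrow> real \<Rightarrow> real" where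
  "partial_sum_process n \<omega> t = (1 / sqrt (real n)) * (\<Sum>j\<in>{1..\<lfloor>real n * t\<rfloor>}. Y j \<omega>)"

lemma partial_sum_process_cadlag01: "partial_sum_process n \<omega> \<in> cadlag01"
  using floor_step_cadlag01[of "\<lambda>k. (1 / sqrt (real n)) * (\<Sum>j\<in>{1..k}. Y j \<omega>)" n]
  by (simp add: partial_sum_process_def[abs_def])

lemma sum_int_eq_S: "(\<Sum>j\<in>{1..int k}. Y j \<omega>) = S k \<omega>"
  unfolding S_def by (rule sum.reindex_bij_witness[of _ int nat]) auto

lemma partial_sum_process_eq:
  assumes "t \<ge> 0"
  shows "partial_sum_process n \<omega> t = S (nat \<lfloor>real n * t\<rfloor>) \<omega> / sqrt (real n)"
proof -
  have "\<lfloor>real n * t\<rfloor> = int (nat \<lfloor>real n * t\<rfloor>)" using assms by simp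
  then show ?thesis unfolding partial_sum_process_def by (metis mult.commute sum_int_eq_S times_divide_eq_right mult.right_neutral)
qed

lemma partial_sum_process_1: "partial_sum_process n \<omega> 1 = S n \<omega> / sqrt (real n)"
  by (simp add: partial_sum_process_eq)

lemma measurable_bridge_sup_process [measurable]:
  "(\<lambda>\<omega>. bridge_sup (partial_sum_process n \<omega>)) \<in> borel_measurable M"
proof (rule measurable_bridge_sup)
  show "(\<lambda>\<omega>. partial_sum_process n \<omega> t) \<in> borel_measurable M" for t
    unfolding partial_sum_process_def by measurable
qed (rule partial_sum_process_cadlag01)

definition cusum_max :: "nat \<Rightarrow> 'a \<Rightarrow> real" where
  "cusum_max n \<omega> = Max ((\<lambda>k. \<bar>S k \<omega> - real k / real n * S n \<omega>\<bar>) ` {1..n})"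

lemma cusum_max_le_bridge_sup:
  assumes n: "n > 0"
  shows "cusum_max n \<omega> / sqrt (real n) \<le> bridge_sup (partial_sum_process n \<omega>)"
proof -
  have "cusum_max n \<omega> \<le> bridge_sup (partial_sum_process n \<omega>) * sqrt (real n)"
    unfolding cusum_max_def
  proof (rule Max.boundedI)
    fix a assume "a \<in> (\<lambda>k. \<bar>S k \<omega> - real k / real n * S n \<omega>\<bar>) ` {1..n}"
    then obtain k where k: "k \<in> {1..n}" "a = \<bar>S k \<omega> - real k / real n * S n \<omega>\<bar>" by blast
    let ?t = "real k / real n"
    have t: "?t \<in> {0..1}" using k n by auto
    have "partial_sum_process n \<omega> ?t - ?t * partial_sum_process n \<omega> 1
        = (S k \<omega> - ?t * S n \<omega>) / sqrt (real n)"
      using n by (simp add: partial_sum_process_eq diff_divide_distrib)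
    then have "a / sqrt (real n) = \<bar>partial_sum_process n \<omega> ?t - ?t * partial_sum_process n \<omega> 1\<bar>"
      using k by simp
    also have "\<dots> \<le> bridge_sup (partial_sum_process n \<omega>)"
      by (rule bridge_sup_upper[OF partial_sum_process_cadlag01 t])
    finally show "a \<le> bridge_sup (partial_sum_process n \<omega>) * sqrt (real n)"
      using n by (simp add: pos_divide_le_eq)
  qed (use n in auto)
  then show ?thesis using n by (simp add: pos_divide_le_eq)
qed

text \<open>Between grid points the partial sum is constant while the drift moves by at most
  \<open>\<bar>S n \<omega>\<bar> / n\<close>, which accounts for the extra term.\<close>

lemma bridge_sup_le_cusum_max:
  assumes n: "n > 0"
  shows "bridge_sup (partial_sum_process n \<omega>)
       \<le> cusum_max n \<omega> / sqrt (real n) + \<bar>S n \<omega>\<bar> / (real n * sqrt (real n))"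
proof (rule bridge_sup_least)
  fix t :: real assume t: "t \<in> {0..1}"
  define k where "k = nat \<lfloor>real n * t\<rfloor>"
  have k: "real k \<le> real n * t" "real n * t < real k + 1" using t by (auto simp: k_def)
  have "real k \<le> real n"
  proof -
    have "real n * t \<le> real n * 1" using t by (intro mult_left_mono) auto
    then show ?thesis using k(1) by (metis mult.right_neutral order.trans)
  qed
  then have kn: "k \<le> n" by simp
  have ub: "\<bar>S j \<omega> - real j / real n * S n \<omega>\<bar> \<le> cusum_max n \<omega>" if "j \<in> {1..n}" for j
    unfolding cusum_max_def using that by (intro Max_ge) auto
  have 1: "\<bar>S k \<omega> - real k / real n * S n \<omega>\<bar> \<le> cusum_max n \<omega>"
  \<comment> \<open>Times in the first cell round down to 0, an index missing from the maximum over
    \<open>{1..n}\<close>; the deviation there is 0.\<close>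
  proof (cases "k = 0")
    case True
    then have "S k \<omega> - real k / real n * S n \<omega> = 0" by (simp add: S_def)
    also have "0 \<le> cusum_max n \<omega>" using ub[of n] n by (intro order.trans[OF abs_ge_zero ub]) auto
    finally show ?thesis using \<open>S k \<omega> - _ = 0\<close> by simp
  qed (use ub kn in auto)
  have "\<bar>t - real k / real n\<bar> \<le> 1 / real n"
  proof -
    have "t - real k / real n = (real n * t - real k) / real n" using n by (simp add: field_simps)
    moreover have "\<bar>real n * t - real k\<bar> \<le> 1" using k by linarith
    ultimately show ?thesis using n by (simp add: abs_divide divide_right_mono)
  qed
  then have 2: "\<bar>(t - real k / real n) * S n \<omega>\<bar> \<le> 1 / real n * \<bar>S n \<omega>\<bar>"
    unfolding abs_mult by (intro mult_right_mono) auto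
  have "partial_sum_process n \<omega> t - t * partial_sum_process n \<omega> 1
      = ((S k \<omega> - real k / real n * S n \<omega>) - (t - real k / real n) * S n \<omega>) / sqrt (real n)"
    using t by (simp add: partial_sum_process_eq k_def diff_divide_distrib[symmetric] algebra_simps)
  then have "\<bar>partial_sum_process n \<omega> t - t * partial_sum_process n \<omega> 1\<bar>
      = \<bar>(S k \<omega> - real k / real n * S n \<omega>) - (t - real k / real n) * S n \<omega>\<bar> / sqrt (real n)"
    by simp
  also have "\<dots> \<le> (cusum_max n \<omega> + 1 / real n * \<bar>S n \<omega>\<bar>) / sqrt (real n)"
    by (rule divide_right_mono[OF order.trans[OF abs_triangle_ineq4 add_mono[OF 1 2]]]) simp
  finally show "\<bar>partial_sum_process n \<omega> t - t * partial_sum_process n \<omega> 1\<bar>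
      \<le> cusum_max n \<omega> / sqrt (real n) + \<bar>S n \<omega>\<bar> / (real n * sqrt (real n))"
    by (simp add: add_divide_distrib)
qed

section \<open>Consistency of the long-run variance estimate\<close>

definition lrv :: "real \<Rightarrow> nat \<Rightarrow> nat \<Rightarrow> 'a \<Rightarrow> real" where
  "lrv \<mu> n q \<omega> = lrv_estimate (\<lambda>i. \<mu> + y i \<omega>) n q"

lemma measurable_lrv [measurable]: "lrv \<mu> n q \<in> borel_measurable M"
  unfolding lrv_def[abs_def] lrv_estimate_def sample_autocov_def sample_mean_def by measurable

lemma cusum_stat_eq:
  assumes n: "n > 0"
  shows "cusum_stat (\<lambda>i. \<mu> + y i \<omega>) n q = cusum_max n \<omega> / sqrt (real n) / sqrt (lrv \<mu> n q \<omega>)"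
proof -
  have "(\<Sum>i=1..k. \<mu> + y i \<omega>) - real k / real n * (\<Sum>i=1..n. \<mu> + y i \<omega>)
      = S k \<omega> - real k / real n * S n \<omega>" for k
    using n by (simp add: S_def sum.distrib algebra_simps)
  then show ?thesis unfolding cusum_stat_def cusum_max_def lrv_def by simp
qed

text \<open>The error splits into the centring error \<open>R\<close>, the fluctuation
  \<open>V\<close> and a deterministic bias, with one term of the bound for each.\<close>

lemma lrv_L1_error:
  assumes n: "n > 0"
  shows "integrable M (\<lambda>\<omega>. \<bar>lrv \<mu> n q \<omega> - c\<bar>)"
    and "expectation (\<lambda>\<omega>. \<bar>lrv \<mu> n q \<omega> - c\<bar>) \<le> 3 * (2 * real q + 1) / real n * \<Gamma>
        + sqrt ((2 * real q + 1) / real n * (2 * \<Gamma>\<^sup>2 + C)) + \<bar>bartlett_mean n q - c\<bar>"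
proof -
  define V where "V \<omega> = (\<Sum>i=1..n. \<Sum>k=1..n. bartlett_kernel q i k * (y i \<omega> * y k \<omega>)) / real n - bartlett_mean n q" for \<omega>
  define R where "R \<omega> = (\<Sum>i=1..n. \<Sum>k=1..n. bartlett_kernel q i k * ((y i \<omega> - S n \<omega> / real n) * (y k \<omega> - S n \<omega> / real n))) / real n
      - (\<Sum>i=1..n. \<Sum>k=1..n. bartlett_kernel q i k * (y i \<omega> * y k \<omega>)) / real n" for \<omega>
  have [measurable]: "V \<in> borel_measurable M" unfolding V_def[abs_def] by measurable
  have V2: "integrable M (\<lambda>\<omega>. (V \<omega>)\<^sup>2)" "expectation (\<lambda>\<omega>. (V \<omega>)\<^sup>2) \<le> (2 * real q + 1) / real n * (2 * \<Gamma>\<^sup>2 + C)"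
    unfolding V_def by (rule bartlett_form_variance[OF n])+
  have V1: "integrable M V" "expectation (\<lambda>\<omega>. \<bar>V \<omega>\<bar>) \<le> sqrt ((2 * real q + 1) / real n * (2 * \<Gamma>\<^sup>2 + C))"
    using expectation_abs_le_sqrt[OF _ V2(1)] order.trans[OF _ real_sqrt_le_mono[OF V2(2)]] by auto
  have R1: "integrable M R" "expectation (\<lambda>\<omega>. \<bar>R \<omega>\<bar>) \<le> 3 * (2 * real q + 1) / real n * \<Gamma>"
    unfolding R_def[abs_def] by (rule bartlett_centring_error[OF n])+
  have "sample_mean (\<lambda>i. \<mu> + y i \<omega>) n = \<mu> + S n \<omega> / real n" for \<omega>
    using n by (simp add: sample_mean_def S_def sum.distrib add_divide_distrib)
  then have eq: "lrv \<mu> n q \<omega> = R \<omega> + V \<omega> + bartlett_mean n q" for \<omega>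
    unfolding lrv_def lrv_estimate_quadratic_form R_def V_def by simp
  show int: "integrable M (\<lambda>\<omega>. \<bar>lrv \<mu> n q \<omega> - c\<bar>)"
    unfolding eq using R1 V1 by simp
  have "expectation (\<lambda>\<omega>. \<bar>lrv \<mu> n q \<omega> - c\<bar>)
      \<le> expectation (\<lambda>\<omega>. \<bar>R \<omega>\<bar> + \<bar>V \<omega>\<bar> + \<bar>bartlett_mean n q - c\<bar>)"
    using int R1 V1 by (intro integral_mono) (auto simp: eq)
  also have "\<dots> = expectation (\<lambda>\<omega>. \<bar>R \<omega>\<bar>) + expectation (\<lambda>\<omega>. \<bar>V \<omega>\<bar>) + \<bar>bartlett_mean n q - c\<bar>"
    using R1 V1 by (simp add: prob_space)
  finally show "expectation (\<lambda>\<omega>. \<bar>lrv \<mu> n q \<omega> - c\<bar>) \<le> 3 * (2 * real q + 1) / real n * \<Gamma>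
        + sqrt ((2 * real q + 1) / real n * (2 * \<Gamma>\<^sup>2 + C)) + \<bar>bartlett_mean n q - c\<bar>"
    using R1 V1 by linarith
qed

lemma lrv_L1_tendsto:
  assumes q: "filterlim q at_top sequentially" and qn: "(\<lambda>n. real (q n) / real n) \<longlonglongrightarrow> 0"
    and S2: "(\<lambda>n. expectation (\<lambda>\<omega>. (S n \<omega>)\<^sup>2) / real n) \<longlonglongrightarrow> c"
  shows "(\<lambda>n. expectation (\<lambda>\<omega>. \<bar>lrv \<mu> n (q n) \<omega> - c\<bar>)) \<longlonglongrightarrow> 0"
proof (rule tendsto_sandwich[OF _ _ tendsto_const])
  let ?r = "\<lambda>n. (2 * real (q n) + 1) / real n"
  have "(\<lambda>n. 2 * (real (q n) / real n) + 1 / real n) \<longlonglongrightarrow> 2 * 0 + 0"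
    by (intro tendsto_intros qn lim_1_over_n)
  then have r: "?r \<longlonglongrightarrow> 0" by (simp add: add_divide_distrib)
  have "(\<lambda>n. (bartlett_mean n (q n) - expectation (\<lambda>\<omega>. (S n \<omega>)\<^sup>2) / real n) + expectation (\<lambda>\<omega>. (S n \<omega>)\<^sup>2) / real n) \<longlonglongrightarrow> 0 + c"
    by (intro tendsto_add bartlett_bias_tendsto q S2)
  then have m: "(\<lambda>n. bartlett_mean n (q n)) \<longlonglongrightarrow> c" by simp
  have "(\<lambda>n. 3 * ?r n * \<Gamma> + sqrt (?r n * (2 * \<Gamma>\<^sup>2 + C)) + \<bar>bartlett_mean n (q n) - c\<bar>)
      \<longlonglongrightarrow> 3 * 0 * \<Gamma> + sqrt (0 * (2 * \<Gamma>\<^sup>2 + C)) + \<bar>c - c\<bar>"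
    by (intro tendsto_intros r m)
  then show "(\<lambda>n. 3 * ?r n * \<Gamma> + sqrt (?r n * (2 * \<Gamma>\<^sup>2 + C)) + \<bar>bartlett_mean n (q n) - c\<bar>) \<longlonglongrightarrow> 0"
    by simp
  show "\<forall>\<^sub>F n in sequentially. expectation (\<lambda>\<omega>. \<bar>lrv \<mu> n (q n) \<omega> - c\<bar>)
      \<le> 3 * ?r n * \<Gamma> + sqrt (?r n * (2 * \<Gamma>\<^sup>2 + C)) + \<bar>bartlett_mean n (q n) - c\<bar>"
    using eventually_gt_at_top[of 0]
  proof eventually_elim
    case (elim n)
    then show ?case using lrv_L1_error(2)[of n \<mu> "q n" c] by (simp only: times_divide_eq_right)
  qed
qed auto

text \<open>This is the gap between the grid maximum and the supremum over [0, 1].\<close>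

lemma S_L1_tendsto: "(\<lambda>n. expectation (\<lambda>\<omega>. \<bar>S n \<omega>\<bar> / (real n * sqrt (real n)))) \<longlonglongrightarrow> 0"
proof (rule tendsto_sandwich[OF _ _ tendsto_const])
  have "(\<lambda>n. sqrt \<Gamma> * (1 / real n)) \<longlonglongrightarrow> sqrt \<Gamma> * 0" by (intro tendsto_intros lim_1_over_n)
  then show "(\<lambda>n. sqrt \<Gamma> * (1 / real n)) \<longlonglongrightarrow> 0" by simp
  show "\<forall>\<^sub>F n in sequentially. expectation (\<lambda>\<omega>. \<bar>S n \<omega>\<bar> / (real n * sqrt (real n))) \<le> sqrt \<Gamma> * (1 / real n)"
    using eventually_gt_at_top[of 0]
  proof eventually_elim
    case (elim n)
    have "expectation (\<lambda>\<omega>. \<bar>S n \<omega>\<bar>) \<le> sqrt (expectation (\<lambda>\<omega>. (S n \<omega>)\<^sup>2))"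
      by (rule expectation_abs_le_sqrt(2)) (auto intro: S_second_moment)
    also have "\<dots> \<le> sqrt (real n * \<Gamma>)" using S_second_moment by simp
    finally have "expectation (\<lambda>\<omega>. \<bar>S n \<omega>\<bar>) / (real n * sqrt (real n)) \<le> sqrt (real n * \<Gamma>) / (real n * sqrt (real n))"
      by (rule divide_right_mono) simp
    then show ?case using elim by (simp add: real_sqrt_mult field_simps)
  qed
qed (auto intro!: always_eventually)

lemma S_second_moment_tendsto:
  assumes W: "wiener01 N W"
    and conv: "conv_distr_D01 M partial_sum_process N (\<lambda>\<omega> t. \<sigma> * W t \<omega>)"
  shows "(\<lambda>n. expectation (\<lambda>\<omega>. (S n \<omega>)\<^sup>2) / real n) \<longlonglongrightarrow> \<sigma>\<^sup>2"
proof -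
  have Wm: "W t \<in> borel_measurable N" for t using W by (simp add: wiener01_def)
  have "(\<lambda>n. expectation (\<lambda>\<omega>. (S n \<omega> / sqrt (real n))\<^sup>2)) \<longlonglongrightarrow> integral\<^sup>L N (\<lambda>\<omega>. (\<sigma> * W 1 \<omega>)\<^sup>2)"
  proof (rule second_moment_tendsto[OF prob_space_axioms])
    show "prob_space N" using W by (simp add: wiener01_def)
    show "(\<lambda>\<omega>. S n \<omega> / sqrt (real n)) \<in> borel_measurable M" for n by measurable
    show "integrable M (\<lambda>\<omega>. (S n \<omega> / sqrt (real n)) ^ 4)" for n
      using S_fourth_moment(1) by (simp add: power_divide)
    show "expectation (\<lambda>\<omega>. (S n \<omega> / sqrt (real n)) ^ 4) \<le> 6 * \<Gamma>\<^sup>2 + 2 * C" for n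
    \<comment> \<open>At \<open>n = 0\<close> the normalised sum is 0 by the convention for division
      by zero, so only the sign of the bound matters.\<close>
    proof (cases "n = 0")
      case False
      have "sqrt (real n) ^ 4 = (real n)\<^sup>2"
        by (metis (no_types) abs_of_nat mult_2 numeral_Bit0 power_add power2_eq_square real_sqrt_abs real_sqrt_mult_self)
      then have "expectation (\<lambda>\<omega>. (S n \<omega> / sqrt (real n)) ^ 4) = expectation (\<lambda>\<omega>. (S n \<omega>) ^ 4) / (real n)\<^sup>2"
        by (simp add: power_divide)
      also have "\<dots> \<le> 6 * \<Gamma>\<^sup>2 + 2 * C"
        using S_fourth_moment(2)[of n] False by (simp add: pos_divide_le_eq)
      finally show ?thesis .
    qed (use C_nonneg in simp)
    show "(\<lambda>\<omega>. \<sigma> * W 1 \<omega>) \<in> borel_measurable N" using Wm by measurable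
    show "integrable N (\<lambda>\<omega>. (\<sigma> * W 1 \<omega>) ^ 4)"
      using wiener01_endpoint_moments[OF W] by (simp add: power_mult_distrib)
    fix K :: real assume K: "K > 0"
    have "continuous_on UNIV (\<lambda>u::real. min (u\<^sup>2) K)" by (intro continuous_intros)
    then have "skorokhod_continuous (\<lambda>x. min ((x 1)\<^sup>2) K)" by (rule skorokhod_continuous_endpoint)
    moreover have "\<forall>x :: real \<Rightarrow> real. \<bar>min ((x 1)\<^sup>2) K\<bar> \<le> K" using K by (auto simp: min_def)
    ultimately have "(\<lambda>n. expectation (\<lambda>\<omega>. min ((partial_sum_process n \<omega> 1)\<^sup>2) K)) \<longlonglongrightarrow> integral\<^sup>L N (\<lambda>\<omega>. min ((\<sigma> * W 1 \<omega>)\<^sup>2) K)"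
      using conv unfolding conv_distr_D01_def by blast
    then show "(\<lambda>n. expectation (\<lambda>\<omega>. min ((S n \<omega> / sqrt (real n))\<^sup>2) K)) \<longlonglongrightarrow> integral\<^sup>L N (\<lambda>\<omega>. min ((\<sigma> * W 1 \<omega>)\<^sup>2) K)"
      unfolding partial_sum_process_1 .
  qed
  then show ?thesis
    using wiener01_endpoint_moments[OF W] by (simp add: power_divide power_mult_distrib)
qed

end

section \<open>Studentisation and the limit law\<close>

lemma abs_sqrt_diff_le:
  assumes "0 \<le> a" "0 < \<sigma>"
  shows "\<bar>sqrt a - \<sigma>\<bar> \<le> \<bar>a - \<sigma>\<^sup>2\<bar> / \<sigma>"
proof -
  have "\<bar>sqrt a - \<sigma>\<bar> * \<sigma> \<le> \<bar>sqrt a - \<sigma>\<bar> * (sqrt a + \<sigma>)" using assms by (intro mult_left_mono) auto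
  also have "\<dots> = \<bar>(sqrt a - \<sigma>) * (sqrt a + \<sigma>)\<bar>" using assms by (simp add: abs_mult)
  also have "(sqrt a - \<sigma>) * (sqrt a + \<sigma>) = a - \<sigma>\<^sup>2"
    using assms by (simp add: algebra_simps power2_eq_square)
  finally show ?thesis using assms by (simp add: pos_le_divide_eq)
qed

text \<open>The deterministic core of the comparison: \<open>m\<close> stands for the normalised
  CUSUM maximum, \<open>b\<close> for the bridge supremum and \<open>s\<close> for the square root
  of the estimate. The first condition on \<open>e\<close> keeps \<open>s\<close> positive; the
  second absorbs \<open>\<bar>x\<bar> * e\<close> from exchanging \<open>s\<close> for
  \<open>\<sigma>\<close> and \<open>e\<close> from exchanging \<open>m\<close> for
  \<open>b\<close>.\<close>

lemma studentised_sandwich: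
  fixes \<sigma> s m b x d e :: real
  assumes \<sigma>: "0 < \<sigma>" and d: "0 < d" and e: "e \<le> \<sigma> / 2" "(\<bar>x\<bar> + 1) * e \<le> d * \<sigma>"
    and s: "\<bar>s - \<sigma>\<bar> \<le> e" and b: "m \<le> b" "b \<le> m + e"
  shows "m / s \<le> x \<Longrightarrow> b / \<sigma> \<le> x + d" and "b / \<sigma> \<le> x - d \<Longrightarrow> m / s \<le> x"
proof -
  have s0: "s > 0" using \<sigma> s e by linarith
  have e0: "0 \<le> e" using s by linarith
  have "\<bar>x * (s - \<sigma>)\<bar> \<le> \<bar>x\<bar> * e" unfolding abs_mult using s by (intro mult_left_mono) auto
  then have xs: "x * s \<le> x * \<sigma> + \<bar>x\<bar> * e" "x * \<sigma> - \<bar>x\<bar> * e \<le> x * s"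
    by (auto simp: algebra_simps abs_le_iff)
  have xe: "\<bar>x\<bar> * e + e \<le> d * \<sigma>" using e(2) by (simp add: algebra_simps)
  show "b / \<sigma> \<le> x + d" if "m / s \<le> x"
  proof -
    have "m \<le> x * s" using that s0 by (simp add: pos_divide_le_eq)
    then have "b \<le> x * \<sigma> + d * \<sigma>" using b xs xe by linarith
    then show ?thesis by (simp only: pos_divide_le_eq[OF \<sigma>] distrib_right)
  qed
  show "m / s \<le> x" if "b / \<sigma> \<le> x - d"
  proof -
    have "b \<le> (x - d) * \<sigma>" using that by (simp only: pos_divide_le_eq[OF \<sigma>])
    then have "b \<le> x * \<sigma> - d * \<sigma>" by (simp only: left_diff_distrib)
    then have "m \<le> x * s" using b xs xe e0 by linarith
    then show ?thesis using s0 by (simp add: pos_divide_le_eq)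
  qed
qed

context summable_cumulants
begin

lemma cusum_weak_conv:
  fixes N :: "'c measure" and N' :: "'b measure"
  assumes \<sigma>: "\<sigma> > 0" and W: "wiener01 N' W"
    and conv: "conv_distr_D01 M partial_sum_process N' (\<lambda>\<omega> t. \<sigma> * W t \<omega>)"
    and q: "filterlim q at_top sequentially" and qn: "(\<lambda>n. real (q n) / real n) \<longlonglongrightarrow> 0"
    and W': "wiener01 N W'"
  shows "weak_conv_m (\<lambda>n. distr M borel (\<lambda>\<omega>. cusum_stat (\<lambda>i. \<mu> + y i \<omega>) n (q n)))
           (distr N borel (\<lambda>\<omega>. bridge_sup (\<lambda>t. W' t \<omega>)))"
proof (rule weak_conv_m_sandwich)
  let ?A = "\<lambda>n \<omega>. bridge_sup (partial_sum_process n \<omega>) / \<sigma>"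
  show "prob_space M" by (rule prob_space_axioms)
  show "prob_space N" using W' by (simp add: wiener01_def)
  show "(\<lambda>\<omega>. cusum_stat (\<lambda>i. \<mu> + y i \<omega>) n (q n)) \<in> borel_measurable M" for n
  proof -
    have [measurable]: "(\<lambda>\<omega>. lrv_estimate (\<lambda>i. \<mu> + y i \<omega>) n (q n)) \<in> borel_measurable M"
      using measurable_lrv[of \<mu> n "q n"] by (simp add: lrv_def[abs_def])
    have [measurable]: "(\<lambda>\<omega>. Max ((\<lambda>k. \<bar>(\<Sum>i=1..k. \<mu> + y i \<omega>) - real k / real n * (\<Sum>i=1..n. \<mu> + y i \<omega>)\<bar>) ` {1..n}))
        \<in> borel_measurable M"
      by (rule borel_measurable_Max) auto
    show ?thesis unfolding cusum_stat_def by measurable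
  qed
  show "?A n \<in> borel_measurable M" for n by measurable
  show "(\<lambda>\<omega>. bridge_sup (\<lambda>t. W' t \<omega>)) \<in> borel_measurable N"
    by (rule measurable_bridge_sup) (use W' in \<open>auto intro!: continuous_imp_cadlag01 simp: wiener01_def\<close>)
  show "(\<lambda>n. expectation (\<lambda>\<omega>. cts_step a b (?A n \<omega>))) \<longlonglongrightarrow> integral\<^sup>L N (\<lambda>\<omega>. cts_step a b (bridge_sup (\<lambda>t. W' t \<omega>)))"
    if ab: "a < b" for a b
  proof -
    have "continuous_on UNIV (\<lambda>u. cts_step a b (u / \<sigma>))"
      by (rule continuous_on_compose2[OF continuous_on_cts_step[OF ab]]) (use \<sigma> in \<open>auto intro!: continuous_intros\<close>)
    then have "skorokhod_continuous (\<lambda>x. cts_step a b (bridge_sup x / \<sigma>))"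
      by (rule skorokhod_continuous_bridge_sup)
    moreover have "\<forall>x. \<bar>cts_step a b (bridge_sup x / \<sigma>)\<bar> \<le> 1" using cts_step_bounded[OF ab] by blast
    ultimately have "(\<lambda>n. expectation (\<lambda>\<omega>. cts_step a b (?A n \<omega>)))
        \<longlonglongrightarrow> integral\<^sup>L N' (\<lambda>\<omega>. cts_step a b (bridge_sup (\<lambda>t. \<sigma> * W t \<omega>) / \<sigma>))"
      using conv unfolding conv_distr_D01_def by blast
    also have "integral\<^sup>L N' (\<lambda>\<omega>. cts_step a b (bridge_sup (\<lambda>t. \<sigma> * W t \<omega>) / \<sigma>))
        = integral\<^sup>L N' (\<lambda>\<omega>. cts_step a b (bridge_sup (\<lambda>t. W t \<omega>)))"
    proof (rule Bochner_Integration.integral_cong[OF refl])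
      fix \<omega> assume "\<omega> \<in> space N'"
      then have "continuous_on {0..1} (\<lambda>t. W t \<omega>)" using W by (simp add: wiener01_def)
      then have "(\<lambda>t. W t \<omega>) \<in> cadlag01" "(\<lambda>t. \<sigma> * W t \<omega>) \<in> cadlag01"
        by (auto intro!: continuous_imp_cadlag01 continuous_intros)
      then show "cts_step a b (bridge_sup (\<lambda>t. \<sigma> * W t \<omega>) / \<sigma>) = cts_step a b (bridge_sup (\<lambda>t. W t \<omega>))"
        using bridge_sup_scale \<sigma> by simp
    qed
    \<comment> \<open>Here the Wiener process of hypothesis (a) is exchanged for the one underlying
      the bridge.\<close>
    also have "\<dots> = integral\<^sup>L N (\<lambda>\<omega>. cts_step a b (bridge_sup (\<lambda>t. W' t \<omega>)))"
      by (rule wiener01_bridge_sup_expectation[OF W W' continuous_on_cts_step[OF ab] cts_step_bounded[OF ab]])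
    finally show ?thesis .
  qed
  fix x d :: real assume d: "d > 0"
  define e where "e = min (\<sigma> / 2) (d * \<sigma> / (\<bar>x\<bar> + 1))"
  have e: "e > 0" "e \<le> \<sigma> / 2" "(\<bar>x\<bar> + 1) * e \<le> d * \<sigma>"
  proof -
    show "e > 0" using \<sigma> d by (auto simp: e_def)
    show "e \<le> \<sigma> / 2" unfolding e_def by (rule min.cobounded1)
    have "(\<bar>x\<bar> + 1) * e \<le> (\<bar>x\<bar> + 1) * (d * \<sigma> / (\<bar>x\<bar> + 1))" by (intro mult_left_mono) (auto simp: e_def)
    also have "\<dots> = d * \<sigma>" by simp
    finally show "(\<bar>x\<bar> + 1) * e \<le> d * \<sigma>" .
  qed
  \<comment> \<open>Closeness within \<open>\<sigma>^2\<close> makes the estimate nonnegative, so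
    that its square root can be compared with \<open>\<sigma>\<close>; closeness within
    \<open>\<sigma> * e\<close> makes the two differ by at most \<open>e\<close>.\<close>
  define \<eta> where "\<eta> = min (\<sigma>\<^sup>2) (\<sigma> * e)"
  have \<eta>: "\<eta> > 0" using \<sigma> e by (simp add: \<eta>_def)
  let ?D = "\<lambda>n \<omega>. \<bar>S n \<omega>\<bar> / (real n * sqrt (real n))"
  let ?U = "\<lambda>n \<omega>. \<bar>lrv \<mu> n (q n) \<omega> - \<sigma>\<^sup>2\<bar>"
  \<comment> \<open>Markov's inequality and the two L1 limits make the complement
    negligible.\<close>
  define G where "G n = {\<omega>\<in>space M. ?U n \<omega> < \<eta> \<and> ?D n \<omega> < e}" for n
  show "\<exists>G. (\<forall>n. G n \<in> sets M) \<and> (\<lambda>n. prob (space M - G n)) \<longlonglongrightarrow> 0 \<and>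
      (\<forall>\<^sub>F n in sequentially. \<forall>\<omega>\<in>G n. (cusum_stat (\<lambda>i. \<mu> + y i \<omega>) n (q n) \<le> x \<longrightarrow> ?A n \<omega> \<le> x + d)
        \<and> (?A n \<omega> \<le> x - d \<longrightarrow> cusum_stat (\<lambda>i. \<mu> + y i \<omega>) n (q n) \<le> x))"
  proof (intro exI[of _ G] conjI allI)
    show Gm: "G n \<in> sets M" for n unfolding G_def by measurable
    show "(\<lambda>n. prob (space M - G n)) \<longlonglongrightarrow> 0"
    proof (rule tendsto_sandwich[OF _ _ tendsto_const])
      have "(\<lambda>n. expectation (?U n) / \<eta> + expectation (?D n) / e) \<longlonglongrightarrow> 0 / \<eta> + 0 / e"
        by (intro tendsto_intros S_L1_tendsto lrv_L1_tendsto[OF q qn] S_second_moment_tendsto[OF W conv])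
          (use \<eta> e in auto)
      then show "(\<lambda>n. expectation (?U n) / \<eta> + expectation (?D n) / e) \<longlonglongrightarrow> 0" by simp
      show "\<forall>\<^sub>F n in sequentially. prob (space M - G n) \<le> expectation (?U n) / \<eta> + expectation (?D n) / e"
        using eventually_gt_at_top[of 0]
      proof eventually_elim
        case (elim n)
        have "prob (space M - G n) \<le> prob ({\<omega>\<in>space M. ?U n \<omega> \<ge> \<eta>} \<union> {\<omega>\<in>space M. ?D n \<omega> \<ge> e})"
          by (intro finite_measure_mono) (auto simp: G_def)
        also have "\<dots> \<le> prob {\<omega>\<in>space M. ?U n \<omega> \<ge> \<eta>} + prob {\<omega>\<in>space M. ?D n \<omega> \<ge> e}"
          by (intro measure_Un_le) auto
        also have "prob {\<omega>\<in>space M. ?U n \<omega> \<ge> \<eta>} \<le> expectation (?U n) / \<eta>"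
          by (rule integral_Markov_inequality_measure[OF lrv_L1_error(1)[OF elim] sets.empty_sets]) (use \<eta> in auto)
        also have "prob {\<omega>\<in>space M. ?D n \<omega> \<ge> e} \<le> expectation (?D n) / e"
        proof (rule integral_Markov_inequality_measure[OF _ sets.empty_sets])
          have "integrable M (S n)"
            by (rule expectation_abs_le_sqrt(1)) (auto intro: S_second_moment)
          then show "integrable M (?D n)" by simp
        qed (use e in auto)
        finally show ?case by simp
      qed
    qed auto
    show "\<forall>\<^sub>F n in sequentially. \<forall>\<omega>\<in>G n. (cusum_stat (\<lambda>i. \<mu> + y i \<omega>) n (q n) \<le> x \<longrightarrow> ?A n \<omega> \<le> x + d)
        \<and> (?A n \<omega> \<le> x - d \<longrightarrow> cusum_stat (\<lambda>i. \<mu> + y i \<omega>) n (q n) \<le> x)"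
      using eventually_gt_at_top[of 0]
    proof (eventually_elim, intro ballI)
      fix n \<omega> assume n: "0 < n" and \<omega>: "\<omega> \<in> G n"
      have U: "?U n \<omega> < \<sigma>\<^sup>2" "?U n \<omega> < \<sigma> * e" and D: "?D n \<omega> \<le> e"
        using \<omega> by (auto simp: G_def \<eta>_def)
      have "0 \<le> lrv \<mu> n (q n) \<omega>" using U(1) by linarith
      then have "\<bar>sqrt (lrv \<mu> n (q n) \<omega>) - \<sigma>\<bar> \<le> ?U n \<omega> / \<sigma>" using \<sigma> by (rule abs_sqrt_diff_le)
      also have "\<dots> \<le> e" using U(2) \<sigma> by (simp add: pos_divide_le_eq mult.commute)
      finally have s: "\<bar>sqrt (lrv \<mu> n (q n) \<omega>) - \<sigma>\<bar> \<le> e" .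
      have b: "bridge_sup (partial_sum_process n \<omega>) \<le> cusum_max n \<omega> / sqrt (real n) + e"
        using bridge_sup_le_cusum_max[OF n, of \<omega>] D by linarith
      show "(cusum_stat (\<lambda>i. \<mu> + y i \<omega>) n (q n) \<le> x \<longrightarrow> ?A n \<omega> \<le> x + d)
        \<and> (?A n \<omega> \<le> x - d \<longrightarrow> cusum_stat (\<lambda>i. \<mu> + y i \<omega>) n (q n) \<le> x)"
        unfolding cusum_stat_eq[OF n]
        using studentised_sandwich[OF \<sigma> d e(2,3) s cusum_max_le_bridge_sup[OF n] b] by blast
    qed
  qed
qed

end

theorem theorem3p1:
  fixes M :: "'a measure" and Y :: "int \<Rightarrow> 'a \<Rightarrow> real" and \<mu> :: real
    and q :: "nat \<Rightarrow> nat"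
    and N :: "'c measure" and B :: "real \<Rightarrow> 'c \<Rightarrow> real"
  assumes "prob_space M"
    and "fourth_order_stationary M Y"
    and "\<forall>k. integral\<^sup>L M (Y k) = 0"
    and "\<exists>(N' :: 'b measure) W \<sigma>. \<sigma> > 0 \<and> wiener01 N' W \<and>
           conv_distr_D01 M
             (\<lambda>n \<omega> t. (1 / sqrt (real n)) * (\<Sum>j\<in>{1..\<lfloor>real n * t\<rfloor>}. Y j \<omega>))
             N' (\<lambda>\<omega> t. \<sigma> * W t \<omega>)"
    and "(\<lambda>j. \<bar>autocov M Y j\<bar>) summable_on UNIV"
    and "\<exists>C. \<forall>h. (\<lambda>(r, s). \<bar>cum4 M Y h r s\<bar>) summable_on UNIV \<and>
               (\<Sum>\<^sub>\<infinity>(r, s). \<bar>cum4 M Y h r s\<bar>) \<le> C"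
    and "\<forall>n. q n > 0"
    and "filterlim q at_top sequentially"
    and "(\<lambda>n. real (q n) / real n) \<longlonglongrightarrow> 0"
    and "brownian_bridge01 N B"
  shows "weak_conv_m
           (\<lambda>n. distr M borel (\<lambda>\<omega>. cusum_stat (\<lambda>i. \<mu> + Y (int i) \<omega>) n (q n)))
           (distr N borel (\<lambda>\<omega>. SUP t\<in>{0..1}. \<bar>B t \<omega>\<bar>))"
proof -
  obtain C where C: "\<And>h. (\<lambda>(r, s). \<bar>cum4 M Y h r s\<bar>) summable_on UNIV"
    "\<And>h. (\<Sum>\<^sub>\<infinity>(r, s). \<bar>cum4 M Y h r s\<bar>) \<le> C"
    using assms(6) by blast
  interpret summable_cumulants M Y C
    using assms(1,2,3,5) C by (simp add: summable_cumulants_def summable_cumulants_axioms_def)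
  obtain N' :: "'b measure" and W \<sigma> where W: "\<sigma> > 0" "wiener01 N' W"
    "conv_distr_D01 M partial_sum_process N' (\<lambda>\<omega> t. \<sigma> * W t \<omega>)"
    using assms(4) unfolding partial_sum_process_def[abs_def] by blast
  obtain W' where W': "wiener01 N W'" "\<And>t \<omega>. B t \<omega> = W' t \<omega> - t * W' 1 \<omega>"
    using assms(10) unfolding brownian_bridge01_def by blast
  show ?thesis
    using cusum_weak_conv[OF W assms(8,9) W'(1), of \<mu>] by (simp add: bridge_sup_def W'(2))
qed

end
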